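(* Let $\mathbb{P}$ be a distribution on $\mathbb{R}^p$ generated by a PLSEM whose DAG $D^0$ is such that $\mathbb{P}$ is faithful to $D^0$ (so $\mathscr{D}(\mathbb{P})\neq\emptyset$). Then $\mathscr{D}(\mathbb{P})$ equals the set of all consistent DAG extensions of the PDAG $G_{\mathscr{D}(\mathbb{P})}$.
   Context: A DAG $D$ on $\{1,\dots,p\}$ has parent sets $\mathrm{pa}_D(j)$. A PLSEM (partially linear additive structural equation model with Gaussian noise) with DAG $D$ is a system $X_j=\mu_j+\sum_{i\in\mathrm{pa}_D(j)} f_{j,i}(X_i)+\varepsilon_j$, $j=1,\dots,p$, where $\mu_j\in\mathbb{R}$, $f_{j,i}\in C^2(\mathbb{R})$, $f_{j,i}\not\equiv 0$, $\mathbb{E}[f_{j,i}(X_i)]=0$, and $\varepsilon_1,\dots,\varepsilon_p$ are mutually independent with $\varepsilon_j\sim\mathcal{N}(0,\sigma_j^2)$, $\sigma_j^2>0$; the distribution of the (unique) solution $X$ is said to be generated by the PLSEM. $\mathbb{P}$ is faithful to a DAG $D$ if the conditional independences holding in $\mathbb{P}$ are exactly those implied by d-separation in $D$. The distribution equivalence class is $\mathscr{D}(\mathbb{P})=\{D:\ \mathbb{P}\text{ is faithful to }D\text{ and some PLSEM with DAG }D\text{ generates }\mathbb{P}\}$; all its members are Markov equivalent (same skeleton and v-structures). A PDAG is a graph with directed and undirected edges and no directed cycle. $G_{\mathscr{D}(\mathbb{P})}$ is the PDAG with the common skeleton of the DAGs in $\mathscr{D}(\mathbb{P})$, in which $i\to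 j$ is directed iff $i\to j$ in every DAG of $\mathscr{D}(\mathbb{P})$, and otherwise the edge is undirected. A consistent DAG extension of a PDAG $G$ is a DAG with the same skeleton as $G$, the same orientation of every directed edge of $G$, and no v-structures other than those of $G$. *)

theory Defs
  imports "HOL-Probability.Probability"
begin

section \<open>Graphs on a finite vertex type 'n (vertices = UNIV)\<close>

text \<open>A directed graph is a set of ordered pairs (i,j), meaning i -> j.
A DAG is an acyclic such graph.\<close>

definition is_DAG :: "('n \<times> 'n) set \<Rightarrow> bool" where
  "is_DAG E \<longleftrightarrow> acyclic E"

definition pa :: "('n \<times> 'n) set \<Rightarrow> 'n \<Rightarrow> 'n set" where
  "pa E j = {i. (i, j) \<in> E}"

definition skel :: "('n \<times> 'n) set \<Rightarrow> ('n \<times> 'n) set" where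
  "skel E = E \<union> E\<inverse>"

text \<open>d-separation. A path is a list of distinct vertices, consecutive ones adjacent.\<close>

definition is_path :: "('n \<times> 'n) set \<Rightarrow> 'n list \<Rightarrow> bool" where
  "is_path E xs \<longleftrightarrow> xs \<noteq> [] \<and> distinct xs \<and>
     (\<forall>k. Suc k < length xs \<longrightarrow> (xs ! k, xs ! Suc k) \<in> skel E)"

definition collider :: "('n \<times> 'n) set \<Rightarrow> 'n list \<Rightarrow> nat \<Rightarrow> bool" where
  "collider E xs k \<longleftrightarrow> (xs ! (k - 1), xs ! k) \<in> E \<and> (xs ! Suc k, xs ! k) \<in> E"

definition blocked :: "('n \<times> 'n) set \<Rightarrow> 'n set \<Rightarrow> 'n list \<Rightarrow> bool" where
  "blocked E C xs \<longleftrightarrow> (\<exists>k. 0 < k \<and> Suc k < length xs \<and>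
     ((collider E xs k \<and> \<not> (\<exists>w\<in>C. (xs ! k, w) \<in> E\<^sup>*)) \<or>
      (\<not> collider E xs k \<and> xs ! k \<in> C)))"

definition d_separated :: "('n \<times> 'n) set \<Rightarrow> 'n set \<Rightarrow> 'n set \<Rightarrow> 'n set \<Rightarrow> bool" where
  "d_separated E A B C \<longleftrightarrow>
     (\<forall>xs. is_path E xs \<and> hd xs \<in> A \<and> last xs \<in> B \<longrightarrow> blocked E C xs)"

section \<open>Conditional independence of coordinates of a distribution on R^p\<close>

text \<open>The sigma-algebra generated by the coordinates in C.\<close>
definition coord_alg :: "('n \<Rightarrow> real) measure \<Rightarrow> 'n set \<Rightarrow> ('n \<Rightarrow> real) measure" where
  "coord_alg P C = sigma (space P)
     {(\<lambda>x. x i) -` B \<inter> space P | i B. i \<in> C \<and> B \<in> sets borel}"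

text \<open>X_A is independent of X_B given X_C: for all events U in sigma(X_A), V in sigma(X_B),
  P(U \<inter> V | X_C) = P(U | X_C) P(V | X_C) almost surely.\<close>
definition cond_indep :: "('n \<Rightarrow> real) measure \<Rightarrow> 'n set \<Rightarrow> 'n set \<Rightarrow> 'n set \<Rightarrow> bool" where
  "cond_indep P A B C \<longleftrightarrow>
     (\<forall>U \<in> sets (coord_alg P A). \<forall>V \<in> sets (coord_alg P B).
        AE x in P. real_cond_exp P (coord_alg P C) (indicator (U \<inter> V)) x =
                   real_cond_exp P (coord_alg P C) (indicator U) x *
                   real_cond_exp P (coord_alg P C) (indicator V) x)"

definition faithful :: "('n \<Rightarrow> real) measure \<Rightarrow> ('n \<times> 'n) set \<Rightarrow> bool" where
  "faithful P E \<longleftrightarrow>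
     (\<forall>A B C. A \<inter> B = {} \<and> A \<inter> C = {} \<and> B \<inter> C = {} \<longrightarrow>
        (cond_indep P A B C \<longleftrightarrow> d_separated E A B C))"

section \<open>PLSEMs\<close>

definition C2 :: "(real \<Rightarrow> real) \<Rightarrow> bool" where
  "C2 g \<longleftrightarrow> (\<forall>x. g differentiable at x) \<and> (\<forall>x. deriv g differentiable at x) \<and>
            continuous_on UNIV (deriv (deriv g))"

text \<open>Canonical noise space: independent eps_j ~ N(0, sigma_j^2), eps = identity.\<close>
definition noise_space :: "('n \<Rightarrow> real) \<Rightarrow> ('n \<Rightarrow> real) measure" where
  "noise_space \<sigma> = (\<Pi>\<^sub>M j\<in>UNIV. density lborel (normal_density 0 (\<sigma> j)))"

definition Rp :: "('n \<Rightarrow> real) measure" where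
  "Rp = (\<Pi>\<^sub>M j\<in>UNIV. borel)"

text \<open>P is generated by a PLSEM with DAG E.\<close>
definition generated_by_PLSEM :: "('n \<Rightarrow> real) measure \<Rightarrow> ('n \<times> 'n) set \<Rightarrow> bool" where
  "generated_by_PLSEM P E \<longleftrightarrow>
     (\<exists>(\<mu> :: 'n \<Rightarrow> real) (f :: 'n \<Rightarrow> 'n \<Rightarrow> real \<Rightarrow> real) (\<sigma> :: 'n \<Rightarrow> real)
        (X :: ('n \<Rightarrow> real) \<Rightarrow> ('n \<Rightarrow> real)).
        (\<forall>j. \<sigma> j > 0) \<and>
        (\<forall>j. \<forall>i \<in> pa E j. C2 (f j i) \<and> f j i \<noteq> (\<lambda>_. 0) \<and>
             integrable (noise_space \<sigma>) (\<lambda>\<omega>. f j i (X \<omega> i)) \<and>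
             (\<integral>\<omega>. f j i (X \<omega> i) \<partial>noise_space \<sigma>) = 0) \<and>
        X \<in> measurable (noise_space \<sigma>) Rp \<and>
        (\<forall>\<omega> j. X \<omega> j = \<mu> j + (\<Sum>i \<in> pa E j. f j i (X \<omega> i)) + \<omega> j) \<and>
        P = distr (noise_space \<sigma>) Rp X)"

definition distr_equiv_class :: "('n \<Rightarrow> real) measure \<Rightarrow> ('n \<times> 'n) set set" where
  "distr_equiv_class P = {E. is_DAG E \<and> faithful P E \<and> generated_by_PLSEM P E}"

section \<open>PDAGs\<close>

text \<open>A PDAG is a pair (Dir, Und): directed edges Dir (i -> j) and undirected edges Und,
  the latter stored symmetrically.\<close>

definition pdag_of :: "('n \<times> 'n) set set \<Rightarrow> ('n \<times> 'n) set \<times> ('n \<times> 'n) set" where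
  "pdag_of S =
     (let Sk = (\<Union>E\<in>S. skel E);
          Dir = {(i, j). (i, j) \<in> Sk \<and> (\<forall>E\<in>S. (i, j) \<in> E)}
      in (Dir, {(i, j). (i, j) \<in> Sk \<and> (i, j) \<notin> Dir \<and> (j, i) \<notin> Dir}))"

text \<open>v-structures i -> k <- j with i, j non-adjacent, given directed edges and skeleton.\<close>
definition vstructs :: "('n \<times> 'n) set \<Rightarrow> ('n \<times> 'n) set \<Rightarrow> ('n \<times> 'n \<times> 'n) set" where
  "vstructs Dir Sk = {(i, k, j). (i, k) \<in> Dir \<and> (j, k) \<in> Dir \<and> i \<noteq> j \<and> (i, j) \<notin> Sk}"

definition consistent_extension :: "('n \<times> 'n) set \<times> ('n \<times> 'n) set \<Rightarrow> ('n \<times> 'n) set \<Rightarrow> bool" where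
  "consistent_extension G E \<longleftrightarrow>
     (let Dir = fst G; Und = snd G in
       is_DAG E \<and> skel E = skel Dir \<union> Und \<and> Dir \<subseteq> E \<and>
       vstructs E (skel E) \<subseteq> vstructs Dir (skel Dir \<union> Und))"

end

theory Submission
  imports Defs
begin

text \<open>Members of the class have the same d-separations, hence the same skeleton and v-structures. Given a
  consistent extension \<open>E\<close>, take a member \<open>D\<close> of the class with as few edges as possible that \<open>E\<close>
  reverses. If one is left, Chickering's argument yields a covered edge \<open>i \<rightarrow> j\<close> of \<open>D\<close> reversed in \<open>E\<close>;
  it is undirected in the PDAG, so some member \<open>D'\<close> contains \<open>j \<rightarrow> i\<close>. Both models give the same Gaussian
  log-density, a sum of squared residuals. Minimising it over the strict descendants of \<open>i\<close> in \<open>D'\<close>,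
  from the sinks upwards, is an orthogonal projection on the side of \<open>D\<close>, and the result is quadratic in
  \<open>x\<^sub>i\<close>; this forces \<open>f\<^sub>j\<^sub>i\<close> to be affine. Then the noises of \<open>i\<close> and \<open>j\<close> can be rotated so that the edge is
  reversed within the class (faithfulness excludes vanishing functions), contradicting minimality.\<close>

text \<open>A member \<open>D'\<close> containing j -> i may differ from \<open>D\<close> in many
  other edges, so the two models cannot be compared equation by equation, and with nonlinear
  functions the marginal densities have no usable form on the side of \<open>D\<close>. Minimisation
  takes the place of marginalisation: a sink k of \<open>D'\<close> enters the log-density only
  through its own squared residual, which makes the form exactly quadratic in the coordinate of k.
  On the side of \<open>D\<close>, additivity makes the normalised residual vector a constant plus a
  sum of curves, one for each coordinate. Comparing second and mixed derivatives shows that the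
  projected curve of k is a straight line, whose direction can be projected out in turn. Coveredness
  is what lets the reversal stay inside the graph: i and j have the same other parents, so the
  rotated equations need no new edge. That a flip preserves d-separation is shown not on paths but
  through separation in the moral graph of an ancestral set, where only the families of i and j
  change.\<close>

definition upclosed :: "('n \<times> 'n) set \<Rightarrow> 'n set \<Rightarrow> bool" where
  "upclosed E K \<longleftrightarrow> (\<forall>i\<in>K. \<forall>j. (i, j) \<in> E \<longrightarrow> j \<in> K)"

lemma acyclic_minimal:
  fixes E :: "('n::finite \<times> 'n) set"
  assumes "acyclic E" "x \<in> S"
  obtains m where "m \<in> S" "\<And>y. (y, m) \<in> E\<^sup>+ \<Longrightarrow> y \<notin> S"
proof -
  have "acyclic (E\<^sup>+)"
    using assms(1) by (simp add: acyclic_def)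
  then have "wf (E\<^sup>+)"
    by (simp add: finite_acyclic_wf)
  then show ?thesis
    using assms(2) that by (meson wfE_min)
qed

lemma acyclic_maximal:
  fixes E :: "('n::finite \<times> 'n) set"
  assumes "acyclic E" "x \<in> S"
  obtains m where "m \<in> S" "\<And>y. (m, y) \<in> E\<^sup>+ \<Longrightarrow> y \<notin> S"
proof -
  have "acyclic (E\<inverse>)"
    using assms(1) by simp
  from acyclic_minimal[OF this assms(2)] obtain m
    where "m \<in> S" "\<And>y. (y, m) \<in> (E\<inverse>)\<^sup>+ \<Longrightarrow> y \<notin> S" by blast
  then show ?thesis
    using that by (simp add: trancl_converse)
qed

text \<open>A vertex of the set without ancestors in it can be removed without destroying closure
  under children. Read backwards, this adds vertices from the sinks upwards; both the factorisation
  of the residual map and the elimination of coordinates run along this induction.\<close>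

lemma upclosed_induct [consumes 2, case_names empty insert]:
  fixes E :: "('n::finite \<times> 'n) set"
  assumes "acyclic E" "upclosed E K"
    and "Q {}"
    and step: "\<And>K k. \<lbrakk>upclosed E K; k \<notin> K; \<And>m. (k, m) \<in> E \<Longrightarrow> m \<in> K; Q K\<rbrakk> \<Longrightarrow> Q (insert k K)"
  shows "Q K"
  using assms(2)
proof (induction "card K" arbitrary: K)
  case 0
  then show ?case using assms(3) by simp
next
  case (Suc n)
  then obtain x where "x \<in> K" by fastforce
  from acyclic_minimal[OF assms(1) this]
  obtain k where k: "k \<in> K" "\<And>y. (y, k) \<in> E\<^sup>+ \<Longrightarrow> y \<notin> K" by blast
  let ?K = "K - {k}"
  have "upclosed E ?K"
    using Suc.prems k(2) unfolding upclosed_def by blast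
  moreover have "\<And>m. (k, m) \<in> E \<Longrightarrow> m \<in> ?K"
    using Suc.prems k(1) assms(1) unfolding upclosed_def acyclic_def by blast
  moreover have "n = card ?K" using Suc.hyps(2) k(1) by simp
  ultimately have "Q (insert k ?K)"
    using Suc.hyps(1) step by blast
  then show ?case using k(1) by (simp add: insert_absorb)
qed

lemma upclosed_UNIV: "upclosed E UNIV"
  by (simp add: upclosed_def)

subsection \<open>Active paths\<close>

definition active_path :: "('n \<times> 'n) set \<Rightarrow> 'n set \<Rightarrow> 'n list \<Rightarrow> bool" where
  "active_path E C xs \<longleftrightarrow> is_path E xs \<and> \<not> blocked E C xs"

lemma d_separated_iff_active:
  "d_separated E A B C \<longleftrightarrow> \<not> (\<exists>xs. active_path E C xs \<and> hd xs \<in> A \<and> last xs \<in> B)"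
  by (auto simp: d_separated_def active_path_def)

lemma active_path_singleton: "active_path E C [a]"
  by (simp add: active_path_def is_path_def blocked_def)

lemma active_path_pair:
  assumes "(i, j) \<in> skel E" "i \<noteq> j"
  shows "active_path E C [i, j]"
  using assms by (simp add: active_path_def is_path_def blocked_def less_Suc_eq)

lemma active_path_take:
  assumes "active_path E C xs" "k < length xs"
  shows "active_path E C (take (Suc k) xs)"
proof -
  have "is_path E (take (Suc k) xs)"
    using assms by (auto simp: active_path_def is_path_def)
  moreover have "\<not> blocked E C (take (Suc k) xs)"
    using assms by (auto simp: active_path_def blocked_def collider_def)
  ultimately show ?thesis by (simp add: active_path_def)
qed

lemma active_path_truncate:
  assumes "active_path E C xs" "w \<in> set xs"
  obtains ys where "active_path E C ys" "hd ys = hd xs" "last ys = w" "set ys \<subseteq> set xs"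
proof -
  obtain k where k: "k < length xs" "xs ! k = w"
    using assms(2) by (metis in_set_conv_nth)
  let ?ys = "take (Suc k) xs"
  have "last ?ys = w" using k by (simp add: last_conv_nth take_Suc_conv_app_nth)
  moreover have "hd ?ys = hd xs" using k by (simp add: hd_conv_nth)
  ultimately show ?thesis
    using that[of ?ys] active_path_take[OF assms(1) k(1)] set_take_subset by metis
qed

lemma take_last_two:
  assumes "0 < k" "k < length xs"
  shows "take (Suc k) xs = take (k - 1) xs @ [xs ! (k - 1), xs ! k]"
proof -
  obtain m where "k = Suc m" using assms(1) by (cases k) auto
  then show ?thesis using assms(2) by (simp add: take_Suc_conv_app_nth)
qed

text \<open>Appending \<open>w\<close> turns only the former last vertex into an interior one, so
  the collider test at that vertex is the sole new condition, and it is empty for a path with one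
  vertex.\<close>

lemma active_path_snoc:
  assumes act: "active_path E C xs" and w: "w \<notin> set xs" and e: "(last xs, w) \<in> skel E"
    and ok: "\<And>ys v. xs = ys @ [v, last xs] \<Longrightarrow>
      (if (v, last xs) \<in> E \<and> (w, last xs) \<in> E then \<exists>c\<in>C. (last xs, c) \<in> E\<^sup>* else last xs \<notin> C)"
  shows "active_path E C (xs @ [w])"
proof -
  have ne: "xs \<noteq> []" using act by (simp add: active_path_def is_path_def)
  have "is_path E (xs @ [w])"
    unfolding is_path_def
  proof (intro conjI allI impI)
    show "distinct (xs @ [w])" using act w by (simp add: active_path_def is_path_def)
    fix k assume "Suc k < length (xs @ [w])"
    then consider "Suc k < length xs" | "Suc k = length xs" by fastforce
    then show "((xs @ [w]) ! k, (xs @ [w]) ! Suc k) \<in> skel E"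
    proof cases
      case 1
      then show ?thesis using act by (simp add: active_path_def is_path_def nth_append)
    next
      case 2
      then have "k = length xs - 1" by simp
      then show ?thesis using 2 e ne by (simp add: nth_append last_conv_nth)
    qed
  qed simp
  moreover have "\<not> blocked E C (xs @ [w])"
  proof
    assume "blocked E C (xs @ [w])"
    then obtain k where k: "0 < k" "Suc k < length (xs @ [w])"
      "(collider E (xs @ [w]) k \<and> \<not> (\<exists>c\<in>C. ((xs @ [w]) ! k, c) \<in> E\<^sup>*)) \<or>
       (\<not> collider E (xs @ [w]) k \<and> (xs @ [w]) ! k \<in> C)"
      unfolding blocked_def by blast
    show False
    proof (cases "Suc k < length xs")
      case True
      then have "blocked E C xs"
        using k nth_append_left[of "k - 1" xs "[w]"] nth_append_left[of k xs "[w]"]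
          nth_append_left[of "Suc k" xs "[w]"]
        unfolding blocked_def collider_def by (intro exI[of _ k]) simp
      then show False using act by (simp add: active_path_def)
    next
      case False
      then have kl: "Suc k = length xs" using k(2) by simp
      have l: "last xs = xs ! k" using kl ne by (simp add: last_conv_nth flip: kl)
      have "xs = take (k - 1) xs @ [xs ! (k - 1), xs ! k]"
        using take_last_two[of k xs] kl k(1) by simp
      then have e: "xs = take (k - 1) xs @ [xs ! (k - 1), last xs]" by (simp only: l)
      have "(if (xs ! (k - 1), xs ! k) \<in> E \<and> (w, xs ! k) \<in> E then \<exists>c\<in>C. (xs ! k, c) \<in> E\<^sup>* else xs ! k \<notin> C)"
        using ok[OF e] by (simp only: l)
      then show False using k kl by (auto simp: collider_def nth_append split: if_splits)
    qed
  qed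
  ultimately show ?thesis by (simp add: active_path_def)
qed

lemma active_path_nth_edge:
  assumes "active_path E C xs" "Suc k < length xs"
  shows "(xs ! k, xs ! Suc k) \<in> skel E"
  using assms by (simp add: active_path_def is_path_def)

text \<open>Only interior vertices are tested by \<open>blocked\<close>, so the set may contain
  vertices of \<open>C\<close>.\<close>

definition d_reach :: "('n \<times> 'n) set \<Rightarrow> 'n set \<Rightarrow> 'n set \<Rightarrow> 'n set" where
  "d_reach E A C = {v. \<exists>xs. active_path E C xs \<and> hd xs \<in> A \<and> last xs = v}"

lemma d_separated_iff_d_reach: "d_separated E A B C \<longleftrightarrow> d_reach E A C \<inter> B = {}"
  by (auto simp: d_separated_iff_active d_reach_def)

lemma d_reachI_mem:
  assumes "active_path E C xs" "hd xs \<in> A" "v \<in> set xs"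
  shows "v \<in> d_reach E A C"
proof -
  from active_path_truncate[OF assms(1,3)]
  obtain ys where "active_path E C ys" "hd ys = hd xs" "last ys = v" by blast
  then show ?thesis using assms(2) by (auto simp: d_reach_def)
qed

text \<open>Leaving \<open>u\<close> along an outgoing arrow makes \<open>u\<close> a non-collider,
  for which u outside \<open>C\<close> is enough. Paths have distinct vertices; if \<open>w\<close>
  was already visited, the path truncated at \<open>w\<close> does the job.\<close>

lemma d_reach_forward:
  assumes "acyclic E" "u \<in> d_reach E A C" "u \<notin> C" "(u, w) \<in> E"
  shows "w \<in> d_reach E A C"
proof -
  obtain xs where xs: "active_path E C xs" "hd xs \<in> A" "last xs = u"
    using assms(2) by (auto simp: d_reach_def)
  show ?thesis
  proof (cases "w \<in> set xs")
    case True
    then show ?thesis using d_reachI_mem xs by metis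
  next
    case False
    have "(w, u) \<notin> E" using assms(1,4) by (meson acyclic_def trancl.simps)
    then have "active_path E C (xs @ [w])"
      using xs assms(3,4) False by (intro active_path_snoc) (auto simp: skel_def)
    moreover have "hd (xs @ [w]) \<in> A"
      using xs by (cases xs) (auto simp: active_path_def is_path_def)
    ultimately show ?thesis by (auto simp: d_reach_def)
  qed
qed

lemma d_reach_forward_rtrancl:
  assumes "acyclic E" "(u, w) \<in> E\<^sup>*" "u \<in> d_reach E A C" "\<not> (\<exists>c\<in>C. (u, c) \<in> E\<^sup>*)"
  shows "w \<in> d_reach E A C"
  using assms(2,3)
proof (induction rule: rtrancl_induct)
  case (step y z)
  then have "y \<notin> C" using assms(4) by blast
  then show ?case using d_reach_forward[OF assms(1)] step by blast
qed

text \<open>The directed path from \<open>v\<close> down to \<open>a\<close> is read upwards: its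
  interior vertices are non-colliders and strict descendants of \<open>v\<close>, hence outside
  \<open>C\<close>. That all its vertices are descendants of \<open>v\<close> guarantees that a
  further parent is new; that the last step runs against an arrow guarantees that \<open>v\<close>
  is a non-collider when the path goes on.\<close>

lemma backward_path:
  assumes "acyclic E" "(v, a) \<in> E\<^sup>*" "\<And>u c. (v, u) \<in> E\<^sup>+ \<Longrightarrow> u \<notin> C"
  shows "\<exists>xs. active_path E C xs \<and> hd xs = a \<and> last xs = v \<and> (\<forall>u\<in>set xs. (v, u) \<in> E\<^sup>*) \<and>
    (\<forall>ys u. xs = ys @ [u, v] \<longrightarrow> (v, u) \<in> E)"
  using assms(2,3)
proof (induction rule: converse_rtrancl_induct)
  case base
  show ?case
    by (rule exI[of _ "[a]"]) (simp add: active_path_singleton)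
next
  case (step y z)
  have "\<And>u. (z, u) \<in> E\<^sup>+ \<Longrightarrow> u \<notin> C"
    using step.prems step.hyps(1) by (meson trancl_into_trancl2)
  then obtain xs where xs: "active_path E C xs" "hd xs = a" "last xs = z"
    "\<forall>u\<in>set xs. (z, u) \<in> E\<^sup>*" "\<forall>ys u. xs = ys @ [u, z] \<longrightarrow> (z, u) \<in> E"
    using step.IH by blast
  have "z \<notin> C" using step by blast
  have "y \<notin> set xs"
    using xs(4) step.hyps(1) assms(1) by (meson acyclic_def rtrancl_into_trancl2)
  have "active_path E C (xs @ [y])"
  proof (rule active_path_snoc[OF xs(1) \<open>y \<notin> set xs\<close>])
    show "(last xs, y) \<in> skel E" using step.hyps(1) xs(3) by (simp add: skel_def)
    fix ys v assume "xs = ys @ [v, last xs]"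
    then have "(z, v) \<in> E" using xs by metis
    then have "(v, z) \<notin> E" using assms(1) by (meson acyclic_def trancl.simps)
    then show "if (v, last xs) \<in> E \<and> (y, last xs) \<in> E then \<exists>c\<in>C. (last xs, c) \<in> E\<^sup>* else last xs \<notin> C"
      using xs(3) \<open>z \<notin> C\<close> by simp
  qed
  moreover have "hd (xs @ [y]) = a"
    using xs by (cases xs) (auto simp: active_path_def is_path_def)
  moreover have "\<forall>u\<in>set (xs @ [y]). (y, u) \<in> E\<^sup>*"
    using xs(4) step.hyps(1) by (auto intro: converse_rtrancl_into_rtrancl)
  moreover have "\<forall>ys u. xs @ [y] = ys @ [u, y] \<longrightarrow> (y, u) \<in> E"
    using xs(3) step.hyps(1) by (metis append_Cons append_Nil append_assoc last_snoc same_append_eq append_same_eq)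
  ultimately show ?case by (intro exI[of _ "xs @ [y]"]) simp
qed

text \<open>As \<open>v\<close> has no descendant in \<open>C\<close>, it could not be passed as a
  collider. A path that climbs from \<open>a\<close> to \<open>v\<close> against the arrows passes
  \<open>v\<close> as a non-collider on its way to \<open>w\<close>.\<close>

lemma d_reach_backward_ancestor:
  assumes "acyclic E" "(v, a) \<in> E\<^sup>*" "a \<in> A" "\<not> (\<exists>c\<in>C. (v, c) \<in> E\<^sup>*)" "(w, v) \<in> E"
  shows "w \<in> d_reach E A C"
proof -
  have "\<And>u. (v, u) \<in> E\<^sup>+ \<Longrightarrow> u \<notin> C" using assms(4) by (meson trancl_into_rtrancl)
  then obtain xs where xs: "active_path E C xs" "hd xs = a" "last xs = v"
    "\<forall>u\<in>set xs. (v, u) \<in> E\<^sup>*" "\<forall>ys u. xs = ys @ [u, v] \<longrightarrow> (v, u) \<in> E"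
    using backward_path[OF assms(1,2)] by metis
  have v: "v \<notin> C" using assms(4) by blast
  have w: "w \<notin> set xs"
    using xs(4) assms(1,5) by (meson acyclic_def rtrancl_into_trancl2)
  have "active_path E C (xs @ [w])"
  proof (rule active_path_snoc[OF xs(1) w])
    show "(last xs, w) \<in> skel E" using assms(5) xs(3) by (simp add: skel_def)
    fix ys u assume "xs = ys @ [u, last xs]"
    then have "(v, u) \<in> E" using xs by metis
    then have "(u, v) \<notin> E" using assms(1) by (meson acyclic_def trancl.simps)
    then show "if (u, last xs) \<in> E \<and> (w, last xs) \<in> E then \<exists>c\<in>C. (last xs, c) \<in> E\<^sup>* else last xs \<notin> C"
      using xs(3) v by simp
  qed
  moreover have "hd (xs @ [w]) \<in> A"
    using xs assms(3) by (cases xs) (auto simp: active_path_def is_path_def)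
  ultimately show ?thesis by (auto simp: d_reach_def)
qed

text \<open>The walk arriving at \<open>v\<close> is continued against the arrow \<open>w \<rightarrow> v\<close>; if \<open>v\<close> becomes a collider
  without descendant in \<open>C\<close>, it is an ancestor of \<open>A\<close> (restart there) or of \<open>B\<close> (excluded).\<close>

lemma d_reach_backward:
  assumes "acyclic E" "A \<inter> C = {}" "d_reach E A C \<inter> B = {}"
    and xs: "active_path E C xs" "hd xs \<in> A" "last xs = v"
    and v: "v \<in> C \<Longrightarrow> \<exists>ys u. xs = ys @ [u, v] \<and> (u, v) \<in> E"
    and anc: "s \<in> A \<union> B \<union> C" "(v, s) \<in> E\<^sup>*" and w: "(w, v) \<in> E"
  shows "w \<in> d_reach E A C"
proof (cases "\<exists>c\<in>C. (v, c) \<in> E\<^sup>*")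
  case True
  show ?thesis
  proof (cases "w \<in> set xs")
    case True
    then show ?thesis using d_reachI_mem xs by metis
  next
    case False
    have "active_path E C (xs @ [w])"
    proof (rule active_path_snoc[OF xs(1) False])
      show "(last xs, w) \<in> skel E" using w xs(3) by (simp add: skel_def)
      fix ys u assume 1: "xs = ys @ [u, last xs]"
      show "if (u, last xs) \<in> E \<and> (w, last xs) \<in> E then \<exists>c\<in>C. (last xs, c) \<in> E\<^sup>* else last xs \<notin> C"
        using True v 1 xs(3) w by auto
    qed
    moreover have "hd (xs @ [w]) \<in> A"
      using xs by (cases xs) (auto simp: active_path_def is_path_def)
    ultimately show ?thesis by (auto simp: d_reach_def)
  qed
next
  case False
  then consider "s \<in> A" | "s \<in> B" using anc by blast
  then show ?thesis
  proof cases
    case 1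
    then show ?thesis using d_reach_backward_ancestor[OF assms(1) anc(2) _ False w] by blast
  next
    case 2
    have "v \<in> d_reach E A C" using xs by (auto simp: d_reach_def)
    then have "s \<in> d_reach E A C"
      using d_reach_forward_rtrancl[OF assms(1) anc(2) _ False] by blast
    then show ?thesis using 2 assms(3) by blast
  qed
qed

subsection \<open>d-separation as a colouring of an ancestral set\<close>

text \<open>This is the moral-graph criterion without the moral graph. \<open>W\<close> is an
  ancestral set, and \<open>A'\<close> and \<open>B'\<close> are two colours for
  \<open>W - C\<close>. The families \<open>insert v (pa E v)\<close> are the cliques that
  moralisation creates, so forbidding both colours in one family says that no moral edge joins
  \<open>A'\<close> to \<open>B'\<close>.\<close>

definition separating_colouring ::
  "('n \<times> 'n) set \<Rightarrow> 'n set \<Rightarrow> 'n set \<Rightarrow> 'n set \<Rightarrow> 'n set \<Rightarrow> 'n set \<Rightarrow> 'n set \<Rightarrow> bool" where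
  "separating_colouring E A B C W A' B' \<longleftrightarrow>
     A \<union> B \<union> C \<subseteq> W \<and> (\<forall>v\<in>W. pa E v \<subseteq> W) \<and> A \<subseteq> A' \<and> B \<subseteq> B' \<and> A' \<inter> B' = {} \<and> A' \<union> B' = W - C \<and>
     (\<forall>v\<in>W. insert v (pa E v) \<inter> A' = {} \<or> insert v (pa E v) \<inter> B' = {})"

lemma separating_colouringD:
  assumes "separating_colouring E A B C W A' B'"
  shows "A \<union> B \<union> C \<subseteq> W" "v \<in> W \<Longrightarrow> pa E v \<subseteq> W" "A \<subseteq> A'" "B \<subseteq> B'" "A' \<inter> B' = {}" "A' \<union> B' = W - C"
    "v \<in> W \<Longrightarrow> insert v (pa E v) \<inter> A' = {} \<or> insert v (pa E v) \<inter> B' = {}"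
  using assms by (simp_all add: separating_colouring_def)

text \<open>\<open>W\<close> is the smallest ancestral set containing the three sets, and the first
  colour marks what is d-connected to \<open>A\<close>. By \<open>key\<close>, reachability spreads
  from one vertex of a family outside \<open>C\<close> to the whole family, so no family meets both
  colours.\<close>

lemma separating_colouring_if_d_separated:
  assumes ac: "acyclic E" and dj: "A \<inter> B = {}" "A \<inter> C = {}" "B \<inter> C = {}" and ds: "d_separated E A B C"
  shows "\<exists>W A' B'. separating_colouring E A B C W A' B'"
proof -
  define W where "W = {v. \<exists>s\<in>A \<union> B \<union> C. (v, s) \<in> E\<^sup>*}"
  define A' where "A' = d_reach E A C \<inter> (W - C)"
  define B' where "B' = W - C - A'"
  have rB: "d_reach E A C \<inter> B = {}" using ds by (simp add: d_separated_iff_d_reach)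
  have W: "A \<union> B \<union> C \<subseteq> W" unfolding W_def by blast
  have Wpa: "pa E v \<subseteq> W" if "v \<in> W" for v
    using that unfolding W_def pa_def by (auto intro: converse_rtrancl_into_rtrancl)
  have A: "A \<subseteq> d_reach E A C"
  proof
    fix a assume "a \<in> A"
    then show "a \<in> d_reach E A C"
      using active_path_singleton[of E C a] by (force simp: d_reach_def)
  qed
  have key: "w \<in> d_reach E A C"
    if v: "v \<in> W" and u: "u \<in> insert v (pa E v)" "u \<in> A'" and w: "w \<in> insert v (pa E v)" for u v w
  proof -
    obtain s where s: "s \<in> A \<union> B \<union> C" "(v, s) \<in> E\<^sup>*" using v unfolding W_def by blast
    have uC: "u \<notin> C" and ur: "u \<in> d_reach E A C" using u(2) by (auto simp: A'_def)
    show ?thesis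
    proof (cases "w = u")
      case True
      then show ?thesis using ur by simp
    next
      case wu: False
      show ?thesis
      proof (cases "u = v")
        case True
        then have wv: "(w, v) \<in> E" using w wu by (auto simp: pa_def)
        obtain xs where "active_path E C xs" "hd xs \<in> A" "last xs = v"
          using ur True by (auto simp: d_reach_def)
        then show ?thesis
          using d_reach_backward[OF ac dj(2) rB _ _ _ _ s wv] uC True by blast
      next
        case False
        then have uv: "(u, v) \<in> E" using u(1) by (auto simp: pa_def)
        show ?thesis
        proof (cases "w = v")
          case True
          then show ?thesis using d_reach_forward[OF ac ur uC uv] by simp
        next
          case False
          then have wv: "(w, v) \<in> E" using w by (auto simp: pa_def)
          obtain xs where xs: "active_path E C xs" "hd xs \<in> A" "last xs = u"
            using ur by (auto simp: d_reach_def)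
          have ne: "xs \<noteq> []" using xs(1) by (simp add: active_path_def is_path_def)
          \<comment> \<open>To pass from the parent \<open>u\<close> over \<open>v\<close> to the
            other parent \<open>w\<close>, a path ending in \<open>v\<close> is needed, entering
            \<open>v\<close> by an arrow if \<open>v\<close> lies in \<open>C\<close>. If
            \<open>v\<close> is already on \<open>xs\<close> and in \<open>C\<close>, it is an
            interior vertex there, since the path starts in \<open>A\<close> and ends in
            \<open>u\<close>; being unblocked, it is a collider, and truncation at \<open>v\<close>
            keeps the arrow.\<close>
          obtain zs where zs: "active_path E C zs" "hd zs \<in> A" "last zs = v"
             "v \<in> C \<Longrightarrow> \<exists>ys u. zs = ys @ [u, v] \<and> (u, v) \<in> E"
          proof (cases "v \<in> set xs")
            case False
            have vu: "(v, u) \<notin> E" using ac uv by (meson acyclic_def trancl.simps)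
            have "active_path E C (xs @ [v])"
              using xs uv uC vu False by (intro active_path_snoc) (auto simp: skel_def)
            moreover have "xs @ [v] = butlast xs @ [u, v]"
              using ne xs(3) append_butlast_last_id by fastforce
            moreover have "hd (xs @ [v]) \<in> A" using ne xs by simp
            ultimately show ?thesis using that[of "xs @ [v]"] uv by (metis last_snoc)
          next
            case True
            then obtain k where k: "k < length xs" "xs ! k = v" by (metis in_set_conv_nth)
            let ?zs = "take (Suc k) xs"
            have l: "last ?zs = v" using k by (simp add: last_conv_nth take_Suc_conv_app_nth)
            have h: "hd ?zs \<in> A" using k xs ne by (simp add: hd_conv_nth)
            have "\<exists>ys u. ?zs = ys @ [u, v] \<and> (u, v) \<in> E" if vC: "v \<in> C"
            proof -
              have "v \<noteq> hd xs" using vC xs(2) dj(2) by blast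
              then have k0: "0 < k" using k ne by (metis hd_conv_nth not_gr_zero)
              have "Suc k < length xs"
              proof (rule ccontr)
                assume "\<not> Suc k < length xs"
                then have "k = length xs - 1" using k by simp
                then have "v = last xs" using k ne by (simp add: last_conv_nth)
                then show False using xs(3) \<open>u \<noteq> v\<close> by simp
              qed
              then have "collider E xs k"
                using xs(1) k k0 vC by (auto simp: active_path_def blocked_def)
              then have "(xs ! (k - 1), v) \<in> E" using k by (simp add: collider_def)
              moreover have "?zs = take (k - 1) xs @ [xs ! (k - 1), v]"
                using take_last_two[OF k0 k(1)] k(2) by simp
              ultimately show ?thesis by blast
            qed
            then show ?thesis using that[of ?zs] active_path_take[OF xs(1) k(1)] l h by blast
          qed
          show ?thesis
            by (rule d_reach_backward[OF ac dj(2) rB zs s wv])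
        qed
      qed
    qed
  qed
  have "insert v (pa E v) \<inter> A' = {} \<or> insert v (pa E v) \<inter> B' = {}" if "v \<in> W" for v
    using key[OF that] by (auto simp: B'_def A'_def)
  moreover have "A \<subseteq> A'" using A W dj by (auto simp: A'_def)
  moreover have "B \<subseteq> B'" using W rB dj by (auto simp: B'_def A'_def)
  moreover have "A' \<inter> B' = {}" "A' \<union> B' = W - C" by (auto simp: A'_def B'_def)
  ultimately have "separating_colouring E A B C W A' B'"
    using W Wpa by (simp add: separating_colouring_def)
  then show ?thesis by blast
qed

text \<open>Following the arrows out of a vertex of an active path ends in an end point or in \<open>C\<close>.\<close>

lemma active_path_ancestral:
  assumes act: "active_path E C xs" and W: "\<And>v. v \<in> W \<Longrightarrow> pa E v \<subseteq> W"
    and ends: "hd xs \<in> W" "last xs \<in> W" "C \<subseteq> W"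
    and k: "k < length xs"
  shows "xs ! k \<in> W"
proof (rule ccontr)
  assume nk: "xs ! k \<notin> W"
  have Wanc: "u \<in> W" if "(u, v) \<in> E\<^sup>*" "v \<in> W" for u v
    using that by (induction rule: converse_rtrancl_induct) (use W in \<open>auto simp: pa_def\<close>)
  have ne: "xs \<noteq> []" using k by auto
  have inner: "0 < m \<and> Suc m < length xs" if "m < length xs" "xs ! m \<notin> W" for m
  proof
    show "0 < m" using that ends(1) ne by (metis hd_conv_nth not_gr_zero)
    show "Suc m < length xs"
    proof (rule ccontr)
      assume "\<not> Suc m < length xs"
      then have "m = length xs - 1" using that by simp
      then show False using that ends(2) ne by (simp add: last_conv_nth)
    qed
  qed
  have ncoll: "\<not> collider E xs m" if m: "m < length xs" "xs ! m \<notin> W" for m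
  proof
    assume "collider E xs m"
    then obtain c where "c \<in> C" "(xs ! m, c) \<in> E\<^sup>*"
      using inner[OF m] act by (auto simp: active_path_def blocked_def)
    then show False using Wanc ends(3) m(2) by blast
  qed
  have edge: "(xs ! m, xs ! Suc m) \<in> E \<or> (xs ! Suc m, xs ! m) \<in> E" if "Suc m < length xs" for m
    using active_path_nth_edge[OF act that] by (auto simp: skel_def)
  have "(xs ! (k - 1), xs ! k) \<notin> E \<or> (xs ! Suc k, xs ! k) \<notin> E"
    using ncoll[OF k nk] by (simp add: collider_def)
  then show False
  proof
    assume a: "(xs ! Suc k, xs ! k) \<notin> E"
    have "k + n < length xs \<longrightarrow> xs ! (k + n) \<notin> W \<and> (Suc (k + n) < length xs \<longrightarrow> (xs ! Suc (k + n), xs ! (k + n)) \<notin> E)" for n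
    proof (induction n)
      case 0
      then show ?case using nk a by simp
    next
      case (Suc n)
      show ?case
      proof
        assume l: "k + Suc n < length xs"
        then have e: "(xs ! (k + n), xs ! Suc (k + n)) \<in> E" using Suc edge[of "k + n"] by auto
        then have 1: "xs ! Suc (k + n) \<notin> W" using Suc l W by (auto simp: pa_def)
        then have "\<not> collider E xs (Suc (k + n))" using ncoll l by simp
        then show "xs ! (k + Suc n) \<notin> W \<and> (Suc (k + Suc n) < length xs \<longrightarrow> (xs ! Suc (k + Suc n), xs ! (k + Suc n)) \<notin> E)"
          using 1 e by (simp add: collider_def)
      qed
    qed
    from this[of "length xs - 1 - k"] show False using k ends(2) ne by (simp add: last_conv_nth)
  next
    assume a: "(xs ! (k - 1), xs ! k) \<notin> E"
    have "n \<le> k \<longrightarrow> xs ! (k - n) \<notin> W \<and> (n < k \<longrightarrow> (xs ! (k - Suc n), xs ! (k - n)) \<notin> E)" for n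
    proof (induction n)
      case 0
      then show ?case using nk a by simp
    next
      case (Suc n)
      show ?case
      proof
        assume l: "Suc n \<le> k"
        then have s: "Suc (k - Suc n) = k - n" by simp
        have e: "(xs ! (k - n), xs ! (k - Suc n)) \<in> E" using Suc edge[of "k - Suc n"] l k s by auto
        then have 1: "xs ! (k - Suc n) \<notin> W" using Suc l W by (auto simp: pa_def)
        have "k - Suc n < length xs" using k by simp
        then have "\<not> collider E xs (k - Suc n)" using ncoll 1 by simp
        then have "(xs ! (k - Suc (Suc n)), xs ! (k - Suc n)) \<notin> E"
          using e by (simp add: collider_def s)
        then show "xs ! (k - Suc n) \<notin> W \<and> (Suc n < k \<longrightarrow> (xs ! (k - Suc (Suc n)), xs ! (k - Suc n)) \<notin> E)"
          using 1 by simp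
      qed
    qed
    from this[of k] show False using ends(1) ne by (simp add: hd_conv_nth)
  qed
qed

text \<open>The colour \<open>A'\<close> is carried along an active path starting in
  \<open>A\<close>: adjacent vertices share a family, and an interior vertex in \<open>C\<close> is
  a collider whose two neighbours are both its parents, so the colour jumps over it. The path can
  therefore not end in \<open>B\<close>.\<close>

lemma d_separated_if_separating_colouring:
  assumes ac: "acyclic E" and dj: "A \<inter> B = {}" "A \<inter> C = {}" "B \<inter> C = {}"
    and col: "separating_colouring E A B C W A' B'"
  shows "d_separated E A B C"
  unfolding d_separated_iff_active
proof
  assume "\<exists>xs. active_path E C xs \<and> hd xs \<in> A \<and> last xs \<in> B"
  then obtain xs where xs: "active_path E C xs" "hd xs \<in> A" "last xs \<in> B" by blast
  have ne: "xs \<noteq> []" using xs(1) by (simp add: active_path_def is_path_def)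
  have W: "xs ! k \<in> W" if "k < length xs" for k
    by (rule active_path_ancestral[OF xs(1) separating_colouringD(2)[OF col] _ _ _ that])
      (use separating_colouringD(1)[OF col] xs(2,3) in auto)
  have edge: "(xs ! m, xs ! Suc m) \<in> E \<or> (xs ! Suc m, xs ! m) \<in> E" if "Suc m < length xs" for m
    using active_path_nth_edge[OF xs(1) that] by (auto simp: skel_def)
  have asym: "(u, v) \<in> E \<Longrightarrow> (v, u) \<notin> E" for u v using ac by (meson acyclic_def trancl.simps)
  have fam: "w \<in> A'" if "v \<in> W" "u \<in> insert v (pa E v)" "w \<in> insert v (pa E v)" "u \<in> A'" "w \<notin> C" for u v w
  proof -
    have "w \<in> W" using that(1,3) separating_colouringD(2)[OF col that(1)] by auto
    then have "w \<in> A' \<union> B'" using that(5) by (simp add: separating_colouringD(6)[OF col])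
    then show ?thesis using that(2-4) separating_colouringD(7)[OF col that(1)] by blast
  qed
  have C: "collider E xs m" if "0 < m" "Suc m < length xs" "xs ! m \<in> C" for m
    using xs(1) that by (auto simp: active_path_def blocked_def)
  \<comment> \<open>The second alternative covers a vertex in \<open>C\<close>, which has no colour;
    the colour is then remembered at its predecessor.\<close>
  have "k < length xs \<longrightarrow> (xs ! k \<in> A' \<or> (0 < k \<and> Suc k < length xs \<and> collider E xs k \<and> xs ! (k - 1) \<in> A'))" for k
  proof (induction k)
    case 0
    then show ?case using xs(2) ne separating_colouringD(3)[OF col] by (auto simp: hd_conv_nth)
  next
    case (Suc k)
    show ?case
    proof
      assume l: "Suc k < length xs"
      have endC: "xs ! Suc k \<notin> C" if "\<not> Suc (Suc k) < length xs"
      proof -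
        have "Suc k = length xs - 1" using that l by simp
        then show ?thesis using xs(3) dj(3) ne by (auto simp: last_conv_nth)
      qed
      show "xs ! Suc k \<in> A' \<or> (0 < Suc k \<and> Suc (Suc k) < length xs \<and> collider E xs (Suc k) \<and> xs ! (Suc k - 1) \<in> A')"
      proof (cases "xs ! k \<in> A'")
        case True
        show ?thesis
        proof (cases "xs ! Suc k \<in> C")
          case True
          then show ?thesis using \<open>xs ! k \<in> A'\<close> endC C by force
        next
          case False
          show ?thesis
            using edge[OF l] fam[OF W[of "Suc k"], of "xs ! k" "xs ! Suc k"]
              fam[OF W[of k], of "xs ! k" "xs ! Suc k"] l True False
            by (auto simp: pa_def)
        qed
      next
        case False
        then have c: "0 < k" "collider E xs k" "xs ! (k - 1) \<in> A'" using Suc l by auto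
        then have e: "(xs ! Suc k, xs ! k) \<in> E" "(xs ! (k - 1), xs ! k) \<in> E" by (auto simp: collider_def)
        have "\<not> collider E xs (Suc k)" using asym[OF e(1)] by (simp add: collider_def)
        then have "xs ! Suc k \<notin> C" using C endC by blast
        then show ?thesis
          using fam[OF W[of k], of "xs ! (k - 1)" "xs ! Suc k"] e c l by (auto simp: pa_def)
      qed
    qed
  qed
  from this[of "length xs - 1"] have "last xs \<in> A'"
    using ne by (auto simp: last_conv_nth)
  then show False using xs(3) separating_colouringD(4,5)[OF col] by blast
qed

subsection \<open>Covered edges\<close>

definition covered :: "('n \<times> 'n) set \<Rightarrow> 'n \<Rightarrow> 'n \<Rightarrow> bool" where
  "covered E i j \<longleftrightarrow> (i, j) \<in> E \<and> pa E j = insert i (pa E i)"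

definition flip :: "('n \<times> 'n) set \<Rightarrow> 'n \<Rightarrow> 'n \<Rightarrow> ('n \<times> 'n) set" where
  "flip E i j = insert (j, i) (E - {(i, j)})"

lemma acyclic_irrefl: "acyclic E \<Longrightarrow> (i, i) \<notin> E"
  by (auto simp: acyclic_def)

lemma acyclic_asym: "acyclic E \<Longrightarrow> (i, j) \<in> E \<Longrightarrow> (j, i) \<notin> E"
  by (meson acyclic_def trancl.simps)

lemma pa_flip:
  assumes "acyclic E" "covered E i j"
  shows "pa (flip E i j) i = insert j (pa E i)" "pa (flip E i j) j = pa E i"
    "k \<noteq> i \<Longrightarrow> k \<noteq> j \<Longrightarrow> pa (flip E i j) k = pa E k"
proof -
  have e: "(i, j) \<in> E" "pa E j = insert i (pa E i)" using assms(2) by (auto simp: covered_def)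
  have n: "i \<noteq> j" "i \<notin> pa E i"
    using e(1) acyclic_irrefl[OF assms(1)] by (auto simp: pa_def)
  show "pa (flip E i j) i = insert j (pa E i)" using n(1) by (auto simp: flip_def pa_def)
  have "pa (flip E i j) j = pa E j - {i}" using n(1) by (auto simp: flip_def pa_def)
  then show "pa (flip E i j) j = pa E i" using e(2) n(2) by auto
  show "k \<noteq> i \<Longrightarrow> k \<noteq> j \<Longrightarrow> pa (flip E i j) k = pa E k" by (auto simp: flip_def pa_def)
qed

lemma skel_flip: "covered E i j \<Longrightarrow> skel (flip E i j) = skel E"
  by (auto simp: skel_def flip_def covered_def)

text \<open>A cycle through the new edge would need another directed path from \<open>i\<close> to
  \<open>j\<close>. It enters \<open>j\<close> through a parent other than \<open>i\<close>, which
  is also a parent of \<open>i\<close> by coveredness, so \<open>E\<close> would already have a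
  cycle.\<close>

lemma acyclic_flip:
  assumes ac: "acyclic E" and cov: "covered E i j"
  shows "acyclic (flip E i j)"
  unfolding flip_def acyclic_insert
proof
  let ?F = "E - {(i, j)}"
  show "acyclic ?F" using ac by (rule acyclic_subset) blast
  show "(i, j) \<notin> ?F\<^sup>*"
  proof
    assume "(i, j) \<in> ?F\<^sup>*"
    moreover have "i \<noteq> j" using ac cov by (auto simp: covered_def acyclic_irrefl)
    ultimately obtain w where w: "(i, w) \<in> ?F\<^sup>*" "(w, j) \<in> ?F"
      by (metis rtranclE)
    then have "(w, i) \<in> E" using cov by (auto simp: covered_def pa_def set_eq_iff)
    moreover have "(i, w) \<in> E\<^sup>*" using w(1) by (meson Diff_subset rtrancl_mono subsetD)
    ultimately show False using ac by (meson acyclic_def rtrancl_into_trancl1)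
  qed
qed

lemma covered_flip:
  assumes "acyclic E" "covered E i j"
  shows "covered (flip E i j) j i"
  by (simp add: covered_def pa_flip[OF assms]) (simp add: flip_def)

lemma flip_flip:
  assumes "acyclic E" "covered E i j"
  shows "flip (flip E i j) j i = E"
proof -
  have "(i, j) \<in> E" "(j, i) \<notin> E" using assms acyclic_asym[OF assms(1)] by (auto simp: covered_def)
  then show ?thesis by (auto simp: flip_def)
qed

text \<open>If \<open>j\<close> lies in \<open>W\<close>, then so does \<open>i\<close>, and both
  new families are contained in the old family of \<open>j\<close>; the colouring is kept. If
  \<open>W\<close> contains neither, nothing changes inside \<open>W\<close>. If it contains only
  \<open>i\<close>, then \<open>j\<close> has become a parent of \<open>i\<close> and must be added
  to \<open>W\<close>.\<close>

lemma separating_colouring_flip: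
  assumes ac: "acyclic E" and cov: "covered E i j"
    and col: "separating_colouring E A B C W A' B'"
  shows "\<exists>W A' B'. separating_colouring (flip E i j) A B C W A' B'"
proof -
  let ?F = "flip E i j"
  note paF = pa_flip[OF ac cov]
  have paj: "pa E j = insert i (pa E i)" and ij: "(i, j) \<in> E" using cov by (auto simp: covered_def)
  have ij': "i \<noteq> j" using ac ij by (auto simp: acyclic_irrefl)
  have W: "\<And>v. v \<in> W \<Longrightarrow> pa E v \<subseteq> W"
    and fam: "\<And>v. v \<in> W \<Longrightarrow> insert v (pa E v) \<inter> A' = {} \<or> insert v (pa E v) \<inter> B' = {}"
    and AB: "A \<union> B \<union> C \<subseteq> W" "A \<subseteq> A'" "B \<subseteq> B'" "A' \<inter> B' = {}" "A' \<union> B' = W - C"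
    using separating_colouringD[OF col] by simp_all
  consider (j) "j \<in> W" | (i) "i \<in> W" "j \<notin> W" | (none) "i \<notin> W" "j \<notin> W" by blast
  then show ?thesis
  proof cases
    case j
    then have iW: "i \<in> W" using W paj by blast
    have "separating_colouring ?F A B C W A' B'"
      unfolding separating_colouring_def
    proof (intro conjI ballI)
      fix v assume v: "v \<in> W"
      show "pa ?F v \<subseteq> W"
        using W[OF v] W[OF iW] j v paF by (cases "v = i"; cases "v = j") auto
      show "insert v (pa ?F v) \<inter> A' = {} \<or> insert v (pa ?F v) \<inter> B' = {}"
        using fam[OF v] fam[OF j] paF paj by (cases "v = i"; cases "v = j") auto
    qed (use AB in auto)
    then show ?thesis by blast
  next
    case none
    have "separating_colouring ?F A B C W A' B'"
      unfolding separating_colouring_def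
    proof (intro conjI ballI)
      fix v assume v: "v \<in> W"
      then have "v \<noteq> i" "v \<noteq> j" using none by auto
      then show "pa ?F v \<subseteq> W" "insert v (pa ?F v) \<inter> A' = {} \<or> insert v (pa ?F v) \<inter> B' = {}"
        using W[OF v] fam[OF v] paF by auto
    qed (use AB in auto)
    then show ?thesis by blast
  next
    case i
    \<comment> \<open>The new vertex \<open>j\<close> takes a colour that the old family of
      \<open>i\<close> tolerates. No other family in \<open>W\<close> contains \<open>j\<close>,
      because \<open>W\<close> was closed under parents and did not contain it.\<close>
    define A'' where "A'' = (if insert i (pa E i) \<inter> B' = {} then insert j A' else A')"
    define B'' where "B'' = (if insert i (pa E i) \<inter> B' = {} then B' else insert j B')"
    have jn: "j \<notin> A'" "j \<notin> B'" "j \<notin> C" using i AB by auto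
    have "separating_colouring ?F A B C (insert j W) A'' B''"
      unfolding separating_colouring_def
    proof (intro conjI ballI)
      fix v assume v: "v \<in> insert j W"
      show "pa ?F v \<subseteq> insert j W"
        using W[of v] W[OF i(1)] v paF by (cases "v = i"; cases "v = j") auto
      show "insert v (pa ?F v) \<inter> A'' = {} \<or> insert v (pa ?F v) \<inter> B'' = {}"
      proof (cases "v = i \<or> v = j")
        case True
        then have "insert v (pa ?F v) \<subseteq> insert j (insert i (pa E i))" using paF by auto
        moreover have "insert j (insert i (pa E i)) \<inter> A'' = {} \<or> insert j (insert i (pa E i)) \<inter> B'' = {}"
          using fam[OF i(1)] jn ij' by (auto simp: A''_def B''_def)
        ultimately show ?thesis by blast
      next
        case False
        then have "j \<notin> insert v (pa ?F v)" using W[of v] v i paF by auto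
        then show ?thesis using fam[of v] v False paF by (auto simp: A''_def B''_def)
      qed
    qed (use AB jn in \<open>auto simp: A''_def B''_def\<close>)
    then show ?thesis by blast
  qed
qed

lemma d_separated_flip:
  assumes ac: "acyclic E" and cov: "covered E i j"
    and dj: "A \<inter> B = {}" "A \<inter> C = {}" "B \<inter> C = {}"
  shows "d_separated (flip E i j) A B C \<longleftrightarrow> d_separated E A B C"
proof -
  have *: "d_separated (flip E i j) A B C" if "acyclic E" "covered E i j" "d_separated E A B C" for E i j
    using separating_colouring_if_d_separated[OF that(1) dj that(3)]
      separating_colouring_flip[OF that(1,2)] d_separated_if_separating_colouring[OF acyclic_flip[OF that(1,2)] dj]
    by metis
  show ?thesis
    using *[OF ac cov] *[OF acyclic_flip[OF ac cov] covered_flip[OF ac cov]] flip_flip[OF ac cov] by auto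
qed

subsection \<open>Markov equivalence\<close>

text \<open>An active path cannot leave \<open>i\<close> towards a parent, which would be an
  interior non-collider in the conditioning set; it cannot stop there either, as \<open>j\<close> is
  not adjacent to \<open>i\<close>. Having left along an arrow it can never turn round, since a
  collider below \<open>i\<close> would need a descendant among the parents of \<open>i\<close> and
  close a cycle. So its end would be a descendant of \<open>i\<close>.\<close>

lemma parents_d_separate:
  assumes ac: "acyclic E" and ij: "i \<noteq> j" "(i, j) \<notin> skel E" "(i, j) \<notin> E\<^sup>*"
  shows "d_separated E {i} {j} (pa E i)"
  unfolding d_separated_iff_active
proof
  assume "\<exists>xs. active_path E (pa E i) xs \<and> hd xs \<in> {i} \<and> last xs \<in> {j}"
  then obtain xs where xs: "active_path E (pa E i) xs" "hd xs = i" "last xs = j" by blast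
  have ne: "xs \<noteq> []" using xs(1) by (simp add: active_path_def is_path_def)
  have x0: "xs ! 0 = i" using xs ne by (simp add: hd_conv_nth)
  have len: "1 < length xs" using xs ij(1) ne by (metis One_nat_def hd_conv_nth last_conv_nth less_one linorder_neqE_nat length_0_conv diff_self_eq_0)
  have edge: "(xs ! m, xs ! Suc m) \<in> E \<or> (xs ! Suc m, xs ! m) \<in> E" if "Suc m < length xs" for m
    using active_path_nth_edge[OF xs(1) that] by (auto simp: skel_def)
  have lastj: "xs ! (length xs - 1) = j" using xs ne by (simp add: last_conv_nth)
  have desc: "k < length xs \<Longrightarrow> (i, xs ! k) \<in> E\<^sup>* \<and> (0 < k \<longrightarrow> (xs ! (k - 1), xs ! k) \<in> E)" for k
  proof (induction k)
    case 0
    then show ?case using x0 by simp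
  next
    case (Suc k)
    have "(xs ! k, xs ! Suc k) \<in> E"
    proof (cases "k = 0")
      case True
      show ?thesis
      proof (rule ccontr)
        assume "(xs ! k, xs ! Suc k) \<notin> E"
        then have e: "(xs ! 1, i) \<in> E" using edge[OF Suc.prems] True x0 by auto
        then have "xs ! 1 \<noteq> j" using ij(2) by (auto simp: skel_def)
        then have "Suc 1 < length xs" using len lastj by (metis One_nat_def Suc_lessI diff_Suc_1)
        moreover have "\<not> collider E xs 1" using acyclic_asym[OF ac e] x0 by (simp add: collider_def)
        moreover have "xs ! 1 \<in> pa E i" using e by (simp add: pa_def)
        ultimately show False using xs(1) unfolding active_path_def blocked_def by (metis less_one)
      qed
    next
      case False
      show ?thesis
      proof (rule ccontr)
        assume "(xs ! k, xs ! Suc k) \<notin> E"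
        then have "collider E xs k" using edge[OF Suc.prems] Suc False by (auto simp: collider_def)
        then obtain c where c: "c \<in> pa E i" "(xs ! k, c) \<in> E\<^sup>*"
          using xs(1) Suc.prems False by (auto simp: active_path_def blocked_def)
        have "(i, xs ! k) \<in> E\<^sup>*" using Suc by simp
        then have "(i, i) \<in> E\<^sup>+" using c by (metis mem_Collect_eq pa_def rtrancl_into_trancl1 rtrancl_trans)
        then show False using ac by (simp add: acyclic_def)
      qed
    qed
    moreover have "(i, xs ! k) \<in> E\<^sup>*" using Suc by simp
    ultimately show ?case by (simp add: rtrancl.rtrancl_into_rtrancl)
  qed
  show False using desc[of "length xs - 1"] ne ij(3) lastj by simp
qed

lemma path_reverse:
  assumes "active_path E C xs"
  shows "active_path E C (rev xs)"
proof -
  have l: "length xs - Suc k - 1 = length xs - Suc (Suc k)" for k by simp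
  have "is_path E (rev xs)"
    unfolding is_path_def
  proof (intro conjI allI impI)
    show "rev xs \<noteq> []" "distinct (rev xs)" using assms by (auto simp: active_path_def is_path_def)
    fix k assume k: "Suc k < length (rev xs)"
    define m where "m = length xs - Suc (Suc k)"
    have m: "Suc m = length xs - Suc k" "Suc m < length xs" using k by (auto simp: m_def)
    have "(xs ! m, xs ! Suc m) \<in> skel E" using active_path_nth_edge[OF assms m(2)] .
    then show "(rev xs ! k, rev xs ! Suc k) \<in> skel E"
      using k m by (auto simp: rev_nth skel_def m_def)
  qed
  moreover have "\<not> blocked E C (rev xs)"
  proof
    assume "blocked E C (rev xs)"
    then obtain k where k: "0 < k" "Suc k < length xs"
       "(collider E (rev xs) k \<and> \<not> (\<exists>c\<in>C. (rev xs ! k, c) \<in> E\<^sup>*)) \<or>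
       (\<not> collider E (rev xs) k \<and> rev xs ! k \<in> C)"
      unfolding blocked_def by auto
    define m where "m = length xs - Suc k"
    have m: "0 < m" "Suc m < length xs" using k by (auto simp: m_def)
    have r: "rev xs ! k = xs ! m" "rev xs ! (k - 1) = xs ! Suc m" "rev xs ! Suc k = xs ! (m - 1)"
      using k by (auto simp: m_def rev_nth Suc_diff_Suc)
    have "collider E (rev xs) k = collider E xs m"
      unfolding collider_def r by blast
    then have "blocked E C xs" using k(3) m r unfolding blocked_def by metis
    then show False using assms by (simp add: active_path_def)
  qed
  ultimately show ?thesis by (simp add: active_path_def)
qed

lemma d_separated_sym:
  assumes "d_separated E A B C"
  shows "d_separated E B A C"
  unfolding d_separated_iff_active
proof
  assume "\<exists>xs. active_path E C xs \<and> hd xs \<in> B \<and> last xs \<in> A"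
  then obtain xs where xs: "active_path E C xs" "hd xs \<in> B" "last xs \<in> A" by blast
  then have "xs \<noteq> []" by (simp add: active_path_def is_path_def)
  then have "hd (rev xs) \<in> A" "last (rev xs) \<in> B" using xs by (simp_all add: hd_rev last_rev)
  then show False using path_reverse[OF xs(1)] assms unfolding d_separated_iff_active by blast
qed

lemma nonadjacent_d_separated:
  assumes ac: "acyclic E" and ij: "i \<noteq> j" "(i, j) \<notin> skel E"
  obtains C where "i \<notin> C" "j \<notin> C" "d_separated E {i} {j} C"
proof (cases "(i, j) \<in> E\<^sup>*")
  case False
  then show ?thesis
    using that[of "pa E i"] parents_d_separate[OF ac ij False] ij acyclic_irrefl[OF ac]
    by (auto simp: pa_def skel_def)
next
  case True
  have "(j, i) \<notin> E\<^sup>*"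
    using True ij(1) ac by (meson acyclic_impl_antisym_rtrancl antisymD)
  moreover have "(j, i) \<notin> skel E" using ij(2) by (auto simp: skel_def)
  ultimately have "d_separated E {j} {i} (pa E j)"
    using parents_d_separate[OF ac] ij(1) by metis
  then show ?thesis
    using that[of "pa E j"] d_separated_sym ij acyclic_irrefl[OF ac]
    by (auto simp: pa_def skel_def)
qed

lemma not_d_separated_adjacent:
  assumes "(i, j) \<in> skel E" "i \<noteq> j"
  shows "\<not> d_separated E {i} {j} C"
  unfolding d_separated_iff_active using active_path_pair[OF assms, of C]
  by (auto intro!: exI[of _ "[i, j]"])

definition same_d_sep :: "('n \<times> 'n) set \<Rightarrow> ('n \<times> 'n) set \<Rightarrow> bool" where
  "same_d_sep E F \<longleftrightarrow> (\<forall>A B C. A \<inter> B = {} \<and> A \<inter> C = {} \<and> B \<inter> C = {} \<longrightarrow>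
     (d_separated E A B C \<longleftrightarrow> d_separated F A B C))"

lemma same_d_sep_sym: "same_d_sep E F \<Longrightarrow> same_d_sep F E"
  by (auto simp: same_d_sep_def)

lemma same_d_sep_skel:
  assumes "acyclic E" "acyclic F" "same_d_sep E F"
  shows "skel E = skel F"
proof -
  have *: "(i, j) \<in> skel F" if E: "acyclic E" and F: "acyclic F" and EF: "same_d_sep E F" and e: "(i, j) \<in> skel E"
    for i j :: 'a and E F
  proof (rule ccontr)
    assume n: "(i, j) \<notin> skel F"
    have ne: "i \<noteq> j" using E e by (auto simp: skel_def acyclic_irrefl)
    obtain C where "i \<notin> C" "j \<notin> C" "d_separated F {i} {j} C"
      using nonadjacent_d_separated[OF F ne n] .
    then have "d_separated E {i} {j} C" using EF ne by (auto simp: same_d_sep_def)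
    then show False using not_d_separated_adjacent[OF e ne] by blast
  qed
  show ?thesis using *[OF assms] *[OF assms(2,1) same_d_sep_sym[OF assms(3)]] by auto
qed

text \<open>A set separating \<open>i\<close> and \<open>j\<close> must block the path i, k, j.
  Where \<open>k\<close> is a collider this keeps \<open>k\<close> out of the set, and with
  \<open>k\<close> outside the set the same path can only be blocked in the other graph if
  \<open>k\<close> is a collider there too.\<close>

lemma same_d_sep_vstructs:
  assumes "acyclic E" "acyclic F" "same_d_sep E F"
  shows "vstructs E (skel E) = vstructs F (skel F)"
proof -
  have *: "(i, k, j) \<in> vstructs F (skel F)"
    if E: "acyclic E" and F: "acyclic F" and EF: "same_d_sep E F" and e: "(i, k, j) \<in> vstructs E (skel E)"
    for i j k :: 'a and E F
  proof -
    have v: "(i, k) \<in> E" "(j, k) \<in> E" "i \<noteq> j" "(i, j) \<notin> skel E" using e by (auto simp: vstructs_def)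
    have sk: "skel E = skel F" using same_d_sep_skel[OF E F EF] by blast
    have ne: "i \<noteq> k" "j \<noteq> k" using v acyclic_irrefl[OF E] by auto
    obtain C where C: "i \<notin> C" "j \<notin> C" "d_separated E {i} {j} C"
      using nonadjacent_d_separated[OF E v(3,4)] .
    then have CF: "d_separated F {i} {j} C" using EF v(3) by (auto simp: same_d_sep_def)
    have p: "is_path E [i, k, j]" "is_path F [i, k, j]"
      using v ne sk by (auto simp: is_path_def less_Suc_eq skel_def)
    have "blocked E C [i, k, j]" using C p by (simp add: d_separated_def)
    then have "k \<notin> C" using v by (auto simp: blocked_def collider_def less_Suc_eq)
    moreover have "blocked F C [i, k, j]" using CF p by (simp add: d_separated_def)
    ultimately have "(i, k) \<in> F \<and> (j, k) \<in> F" by (auto simp: blocked_def collider_def less_Suc_eq)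
    then show ?thesis using v sk by (simp add: vstructs_def)
  qed
  show ?thesis using *[OF assms] *[OF assms(2,1) same_d_sep_sym[OF assms(3)]] by auto
qed

text \<open>Take \<open>y\<close> earliest in \<open>D\<close> among the heads of reversed edges and
  \<open>x\<close> latest among the tails of reversed edges into \<open>y\<close>. A parent of
  \<open>x\<close> not adjacent to \<open>y\<close> would give a v-structure of \<open>E\<close> at
  \<open>x\<close> that \<open>D\<close> lacks; another parent of \<open>y\<close> not adjacent to
  \<open>x\<close> would give one of \<open>D\<close> at \<open>y\<close> that \<open>E\<close>
  lacks. Finally x -> z -> y in \<open>D\<close> would survive in \<open>E\<close> and form a cycle
  with y -> x.\<close>

lemma covered_edge_exists:
  fixes D E :: "('n::finite \<times> 'n) set"
  assumes acD: "acyclic D" and acE: "acyclic E" and sk: "skel D = skel E"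
    and vs: "vstructs D (skel D) = vstructs E (skel E)" and ne: "\<not> D \<subseteq> E"
  obtains i j where "covered D i j" "(i, j) \<notin> E" "(j, i) \<in> E"
proof -
  have rev: "(v, u) \<in> E" if "(u, v) \<in> D" "(u, v) \<notin> E" for u v
    using sk that by (auto simp: skel_def set_eq_iff)
  let ?S = "{y. \<exists>x. (x, y) \<in> D \<and> (x, y) \<notin> E}"
  obtain y0 where "y0 \<in> ?S" using ne by auto
  from acyclic_minimal[OF acD this]
  obtain y where y: "y \<in> ?S" "\<And>z. (z, y) \<in> D\<^sup>+ \<Longrightarrow> z \<notin> ?S" by blast
  let ?T = "{x. (x, y) \<in> D \<and> (x, y) \<notin> E}"
  obtain x0 where "x0 \<in> ?T" using y(1) by auto
  from acyclic_maximal[OF acD this]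
  obtain x where x: "x \<in> ?T" "\<And>z. (x, z) \<in> D\<^sup>+ \<Longrightarrow> z \<notin> ?T" by blast
  have xy: "(x, y) \<in> D" "(x, y) \<notin> E" "(y, x) \<in> E" using x(1) rev by auto
  \<comment> \<open>\<open>u\<close> is an ancestor of \<open>y\<close> in \<open>D\<close>, so by
    the choice of \<open>y\<close> no edge into \<open>u\<close> is reversed.\<close>
  have keep: "(z, u) \<in> E" if "(z, u) \<in> D" "(u, y) \<in> D" for z u
    using y(2)[of u] that by auto
  have cyc3: False if "acyclic F" "(a, b) \<in> F" "(b, c) \<in> F" "(c, a) \<in> F" for a b c :: 'n and F
    using that by (meson acyclic_def trancl.simps)
  have a: "(z, y) \<in> D" if z: "(z, x) \<in> D" for z
  proof -
    have zx: "(z, x) \<in> E" using keep[OF z xy(1)] .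
    have zy: "z \<noteq> y" using acyclic_asym[OF acD xy(1)] z by auto
    have "(z, y) \<in> skel E"
    proof (rule ccontr)
      assume "(z, y) \<notin> skel E"
      then have "(z, x, y) \<in> vstructs E (skel E)" using zx xy zy by (simp add: vstructs_def)
      then have "(z, x, y) \<in> vstructs D (skel D)" by (simp only: vs)
      then have "(y, x) \<in> D" by (auto simp: vstructs_def)
      then show False using acyclic_asym[OF acD xy(1)] by blast
    qed
    then have "(z, y) \<in> D \<or> (y, z) \<in> D" using sk by (auto simp: skel_def)
    then show ?thesis using cyc3[OF acD z xy(1)] by blast
  qed
  have b: "(z, x) \<in> D" if z: "(z, y) \<in> D" "z \<noteq> x" for z
  proof -
    have "(z, x) \<in> skel D"
    proof (rule ccontr)
      assume "(z, x) \<notin> skel D"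
      then have "(z, y, x) \<in> vstructs D (skel D)" using z xy by (simp add: vstructs_def)
      then have "(z, y, x) \<in> vstructs E (skel E)" by (simp only: vs)
      then have "(x, y) \<in> E" by (auto simp: vstructs_def)
      then show False using xy by blast
    qed
    moreover have "(x, z) \<notin> D"
    proof
      assume xz: "(x, z) \<in> D"
      have "(z, y) \<in> E" using x(2)[of z] xz z by auto
      moreover have "(x, z) \<in> E" using keep[OF xz z(1)] .
      ultimately show False using cyc3[OF acE _ _ xy(3)] by blast
    qed
    ultimately show ?thesis by (auto simp: skel_def)
  qed
  have "pa D y = insert x (pa D x)"
    using a b xy by (auto simp: pa_def)
  then show ?thesis using that[of x y] xy by (simp add: covered_def)
qed

subsection \<open>Shears and Lebesgue measure\<close>

abbreviation Leb :: "('n \<Rightarrow> real) measure" where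
  "Leb \<equiv> (\<Pi>\<^sub>M j\<in>UNIV. lborel)"

definition shear :: "'n \<Rightarrow> (('n \<Rightarrow> real) \<Rightarrow> real) \<Rightarrow> ('n \<Rightarrow> real) \<Rightarrow> 'n \<Rightarrow> real" where
  "shear j h x = x(j := x j + h x)"

interpretation lborel_product: product_sigma_finite "\<lambda>_. lborel :: real measure"
  by standard

lemma sets_Rp: "sets (Rp :: ('n \<Rightarrow> real) measure) = sets Leb"
  unfolding Rp_def by (rule sets_PiM_cong) simp_all

lemma space_Rp: "space (Rp :: ('n \<Rightarrow> real) measure) = UNIV"
  by (simp add: Rp_def space_PiM)

lemma space_Leb: "space (Leb :: ('n \<Rightarrow> real) measure) = UNIV"
  by (simp add: space_PiM)

lemma measurable_Rp_component [measurable]: "(\<lambda>x. x i) \<in> borel_measurable (Rp :: ('n \<Rightarrow> real) measure)"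
  unfolding Rp_def by measurable

lemma measurable_Leb_component [measurable]: "(\<lambda>x. x i) \<in> borel_measurable (Leb :: ('n \<Rightarrow> real) measure)"
proof -
  have "(\<lambda>x. x i) \<in> measurable (Leb :: ('n \<Rightarrow> real) measure) lborel"
    by (rule measurable_component_singleton) simp
  then show ?thesis by simp
qed

lemma measurable_shear:
  fixes j :: "'n::finite"
  assumes [measurable]: "h \<in> borel_measurable Leb"
  shows "shear j h \<in> measurable Leb Leb"
proof (rule measurable_PiM_single')
  fix i
  show "(\<lambda>x. shear j h x i) \<in> measurable Leb lborel"
    by (cases "i = j") (simp_all add: shear_def, measurable)
qed (simp add: space_PiM)

text \<open>With the other coordinates fixed, \<open>h\<close> is a constant, and the inner integral
  over coordinate \<open>j\<close> is invariant under translation.\<close>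

lemma shear_preserves_Leb:
  fixes j :: "'n::finite"
  assumes h [measurable]: "h \<in> borel_measurable Leb" and indep: "\<And>x t. h (x(j := t)) = h x"
  shows "distr Leb Leb (shear j h) = Leb"
proof (rule measure_eqI)
  note [measurable] = measurable_shear[OF h, of j]
  fix A assume "A \<in> sets (distr Leb Leb (shear j h))"
  then have A [measurable]: "A \<in> sets Leb" by simp
  let ?I = "UNIV - {j}"
  have I: "insert j ?I = UNIV" by auto
  have insert: "(\<integral>\<^sup>+x. F x \<partial>Leb) = (\<integral>\<^sup>+x. \<integral>\<^sup>+y. F (x(j := y)) \<partial>lborel \<partial>PiM ?I (\<lambda>_. lborel))"
    if "F \<in> borel_measurable Leb" for F :: "('n \<Rightarrow> real) \<Rightarrow> ennreal"
    using lborel_product.product_nn_integral_insert[of ?I j F] that by (simp add: I)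
  have "emeasure (distr Leb Leb (shear j h)) A = (\<integral>\<^sup>+x. indicator A (shear j h x) \<partial>Leb)"
    using nn_integral_distr[of "shear j h" Leb Leb "indicator A :: _ \<Rightarrow> ennreal"] by simp
  also have "\<dots> = (\<integral>\<^sup>+x. \<integral>\<^sup>+y. indicator A (x(j := y + h x)) \<partial>lborel \<partial>PiM ?I (\<lambda>_. lborel))"
  proof -
    have "(\<lambda>x. indicator A (shear j h x) :: ennreal) \<in> borel_measurable Leb" by measurable
    from insert[OF this] show ?thesis by (simp add: shear_def indep)
  qed
  also have "\<dots> = (\<integral>\<^sup>+x. \<integral>\<^sup>+y. indicator A (x(j := y)) \<partial>lborel \<partial>PiM ?I (\<lambda>_. lborel))"
  proof (rule nn_integral_cong)
    fix x :: "'n \<Rightarrow> real" assume x: "x \<in> space (PiM ?I (\<lambda>_. lborel))"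
    have "(\<lambda>y. x(j := y)) \<in> measurable lborel Leb"
      by (rule measurable_PiM_single') (auto simp: space_PiM fun_upd_def)
    then have "(\<lambda>y. indicator A (x(j := y)) :: ennreal) \<in> borel_measurable borel" by measurable
    from nn_integral_real_affine[OF this, of 1 "h x"]
    show "(\<integral>\<^sup>+y. indicator A (x(j := y + h x)) \<partial>lborel) = (\<integral>\<^sup>+y. indicator A (x(j := y)) \<partial>lborel)"
      by (simp add: add.commute)
  qed
  also have "\<dots> = emeasure Leb A"
    by (subst insert[symmetric]) simp_all
  finally show "emeasure (distr Leb Leb (shear j h)) A = emeasure Leb A" .
qed simp

subsection \<open>Gaussian product densities\<close>

definition gauss_product :: "('n::finite \<Rightarrow> real) \<Rightarrow> ('n \<Rightarrow> real) \<Rightarrow> real" where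
  "gauss_product \<sigma> x = (\<Prod>j\<in>UNIV. normal_density 0 (\<sigma> j) (x j))"

lemma gauss_product_measurable [measurable]: "gauss_product \<sigma> \<in> borel_measurable Leb"
  unfolding gauss_product_def by measurable

lemma noise_space_density:
  "noise_space \<sigma> = density Leb (\<lambda>x. ennreal (gauss_product \<sigma> x))"
  if "\<And>j. 0 < \<sigma> j" for \<sigma> :: "'n::finite \<Rightarrow> real"
proof -
  interpret N: product_sigma_finite "\<lambda>j::'n. density lborel (normal_density 0 (\<sigma> j))"
    unfolding product_sigma_finite_def
    by (intro allI prob_space_imp_sigma_finite prob_space_normal_density that)
  have "density Leb (\<lambda>x. ennreal (gauss_product \<sigma> x)) = (\<Pi>\<^sub>M j\<in>UNIV. density lborel (normal_density 0 (\<sigma> j)))"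
  proof (rule N.PiM_eqI)
    show "sets (density Leb (\<lambda>x. ennreal (gauss_product \<sigma> x))) = sets (\<Pi>\<^sub>M j\<in>UNIV. density lborel (normal_density 0 (\<sigma> j)))"
      by (simp cong: sets_PiM_cong)
    fix A :: "'n \<Rightarrow> real set"
    assume "\<And>i. i \<in> UNIV \<Longrightarrow> A i \<in> sets (density lborel (\<lambda>x. ennreal (normal_density 0 (\<sigma> i) x)))"
    then have A [measurable]: "\<And>i. A i \<in> sets borel" by simp
    have [measurable]: "Pi\<^sub>E UNIV A \<in> sets Leb" by (rule sets_PiM_I_finite) auto
    have "emeasure (density Leb (\<lambda>x. ennreal (gauss_product \<sigma> x))) (Pi\<^sub>E UNIV A) =
        (\<integral>\<^sup>+x. (\<Prod>j\<in>UNIV. ennreal (normal_density 0 (\<sigma> j) (x j)) * indicator (A j) (x j)) \<partial>Leb)"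
      by (subst emeasure_density)
        (auto intro!: nn_integral_cong simp: gauss_product_def prod_ennreal prod.distrib indicator_def PiE_iff)
    also have "\<dots> = (\<Prod>j\<in>UNIV. \<integral>\<^sup>+t. ennreal (normal_density 0 (\<sigma> j) t) * indicator (A j) t \<partial>lborel)"
      by (rule lborel_product.product_nn_integral_prod) auto
    also have "\<dots> = (\<Prod>j\<in>UNIV. emeasure (density lborel (normal_density 0 (\<sigma> j))) (A j))"
      by (simp add: emeasure_density)
    finally show "emeasure (density Leb (\<lambda>x. ennreal (gauss_product \<sigma> x))) (Pi\<^sub>E UNIV A) =
      (\<Prod>j\<in>UNIV. emeasure (density lborel (normal_density 0 (\<sigma> j))) (A j))" .
  qed simp
  then show ?thesis by (simp add: noise_space_def)
qed

lemma prob_space_noise: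
  assumes "\<And>j. 0 < \<sigma> j"
  shows "prob_space (noise_space \<sigma>)"
  unfolding noise_space_def by (intro prob_space_PiM prob_space_normal_density assms)

lemma sets_noise_space: "sets (noise_space \<sigma> :: ('n \<Rightarrow> real) measure) = sets Leb"
  unfolding noise_space_def by (rule sets_PiM_cong) simp_all

lemma distr_density_preserving:
  assumes T: "T \<in> measurable M M" and g: "g \<in> borel_measurable M" and pres: "distr M M T = M"
  shows "distr (density M (\<lambda>x. g (T x))) M T = density M g"
  using density_distr[of g M T M] T g pres by simp

text \<open>Conditioning \<open>\<epsilon>\<^sub>i\<close> on \<open>\<eta> = b \<epsilon>\<^sub>i + \<epsilon>\<^sub>j\<close>: \<open>\<epsilon>\<^sub>i = c \<eta> + \<zeta>\<close> with \<open>\<zeta>\<close> independent of \<open>\<eta>\<close>;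
  the map recovers \<open>(\<epsilon>\<^sub>i, \<epsilon>\<^sub>j)\<close> from \<open>(\<zeta>, \<eta>)\<close>.\<close>

definition unmix :: "'n \<Rightarrow> 'n \<Rightarrow> real \<Rightarrow> real \<Rightarrow> ('n \<Rightarrow> real) \<Rightarrow> 'n \<Rightarrow> real" where
  "unmix i j b c x = x(i := x i + c * x j, j := x j - b * (x i + c * x j))"

text \<open>Coordinate \<open>j\<close> receives the standard deviation s of \<eta>, and coordinate
  \<open>i\<close> that of \<zeta>, which is the conditional standard deviation of the noise of
  \<open>i\<close> given \<eta>.\<close>

definition mixed_sd :: "'n \<Rightarrow> 'n \<Rightarrow> real \<Rightarrow> ('n \<Rightarrow> real) \<Rightarrow> 'n \<Rightarrow> real" where
  "mixed_sd i j b \<sigma> = (let s = sqrt (b\<^sup>2 * (\<sigma> i)\<^sup>2 + (\<sigma> j)\<^sup>2) in \<sigma>(i := \<sigma> i * \<sigma> j / s, j := s))"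

lemma mixed_sd_pos:
  assumes "\<And>k. 0 < \<sigma> k"
  shows "0 < mixed_sd i j b \<sigma> k"
proof -
  have "0 < b\<^sup>2 * (\<sigma> i)\<^sup>2 + (\<sigma> j)\<^sup>2"
    using assms[of j] by (intro add_nonneg_pos) auto
  then show ?thesis using assms by (simp add: mixed_sd_def Let_def)
qed

text \<open>Here u is \<zeta>, v is \<eta>, and \<open>w\<close> and \<open>v - b * w\<close> are
  the original noises. The weight of v in \<open>w\<close> is the regression coefficient of the
  noise of i on \<eta>, the value for which the mixed term in u and v cancels. The normalising
  constants agree because the product of the two standard deviations is a d on both sides.\<close>

lemma normal_density_mix:
  fixes a d b u v :: real
  assumes "0 < a" "0 < d"
  defines "s \<equiv> b\<^sup>2 * a\<^sup>2 + d\<^sup>2" and "w \<equiv> u + (b * a\<^sup>2 / (b\<^sup>2 * a\<^sup>2 + d\<^sup>2)) * v"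
  shows "normal_density 0 (a * d / sqrt s) u * normal_density 0 (sqrt s) v =
    normal_density 0 a w * normal_density 0 d (v - b * w)"
proof -
  have s: "0 < s" unfolding s_def using assms(2) by (intro add_nonneg_pos) auto
  define c where "c = b * a\<^sup>2 / s"
  have w: "w = u + c * v" by (simp add: w_def c_def s_def)
  have cs: "c * s = b * a\<^sup>2" using s by (simp add: c_def)
  have sq: "(sqrt s)\<^sup>2 = s" "(a * d / sqrt s)\<^sup>2 = a\<^sup>2 * d\<^sup>2 / s" using s by (simp_all add: power_mult_distrib power_divide)
  have c1: "1 - b * c = d\<^sup>2 / s" using s by (simp add: c_def s_def field_simps power2_eq_square)
  have vw: "v - b * w = d\<^sup>2 / s * v - b * u" by (simp add: w c1[symmetric] algebra_simps)
  have "s * (d\<^sup>2 * w\<^sup>2 + a\<^sup>2 * (v - b * w)\<^sup>2) * s = s * (s * s * u\<^sup>2 + a\<^sup>2 * d\<^sup>2 * v\<^sup>2)"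
  proof -
    have "s * w = s * u + (c * s) * v" unfolding w by (simp add: algebra_simps)
    then have sw: "s * w = s * u + b * a\<^sup>2 * v" by (simp only: cs)
    have svw: "s * (v - b * w) = d\<^sup>2 * v - s * (b * u)" unfolding vw using s by (simp add: right_diff_distrib)
    have "s * (d\<^sup>2 * w\<^sup>2 + a\<^sup>2 * (v - b * w)\<^sup>2) * s = d\<^sup>2 * (s * w)\<^sup>2 + a\<^sup>2 * (s * (v - b * w))\<^sup>2"
      by (simp add: algebra_simps power2_eq_square)
    also have "\<dots> = d\<^sup>2 * (s * u + b * a\<^sup>2 * v)\<^sup>2 + a\<^sup>2 * (d\<^sup>2 * v - s * (b * u))\<^sup>2"
      by (simp only: sw svw)
    also have "\<dots> = s * s * u\<^sup>2 * (d\<^sup>2 + b\<^sup>2 * a\<^sup>2) + a\<^sup>2 * d\<^sup>2 * v\<^sup>2 * (b\<^sup>2 * a\<^sup>2 + d\<^sup>2)"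
      by (simp add: power2_eq_square algebra_simps)
    also have "\<dots> = s * (s * s * u\<^sup>2 + a\<^sup>2 * d\<^sup>2 * v\<^sup>2)"
      by (simp add: s_def algebra_simps)
    finally show ?thesis .
  qed
  then have "s * (d\<^sup>2 * w\<^sup>2 + a\<^sup>2 * (v - b * w)\<^sup>2) = s * s * u\<^sup>2 + a\<^sup>2 * d\<^sup>2 * v\<^sup>2"
    using s by (simp add: mult_ac)
  then have expo: "u\<^sup>2 / (2 * (a\<^sup>2 * d\<^sup>2 / s)) + v\<^sup>2 / (2 * s) = w\<^sup>2 / (2 * a\<^sup>2) + (v - b * w)\<^sup>2 / (2 * d\<^sup>2)"
  proof -
    have "u\<^sup>2 / (2 * (a\<^sup>2 * d\<^sup>2 / s)) + v\<^sup>2 / (2 * s) = (s * s * u\<^sup>2 + a\<^sup>2 * d\<^sup>2 * v\<^sup>2) / (2 * s * a\<^sup>2 * d\<^sup>2)"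
      using s assms(1,2) by (simp add: divide_simps)
    moreover have "w\<^sup>2 / (2 * a\<^sup>2) + (v - b * w)\<^sup>2 / (2 * d\<^sup>2) =
        s * (d\<^sup>2 * w\<^sup>2 + a\<^sup>2 * (v - b * w)\<^sup>2) / (2 * s * a\<^sup>2 * d\<^sup>2)"
      using s assms(1,2) by (simp add: divide_simps)
    ultimately show ?thesis
      using \<open>s * (d\<^sup>2 * w\<^sup>2 + a\<^sup>2 * (v - b * w)\<^sup>2) = s * s * u\<^sup>2 + a\<^sup>2 * d\<^sup>2 * v\<^sup>2\<close> by (simp only:)
  qed
  have root: "sqrt (2 * pi * (a\<^sup>2 * d\<^sup>2 / s)) * sqrt (2 * pi * s) = sqrt (2 * pi * a\<^sup>2) * sqrt (2 * pi * d\<^sup>2)"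
    using s by (simp add: real_sqrt_mult[symmetric] field_simps)
  have "normal_density 0 (a * d / sqrt s) u * normal_density 0 (sqrt s) v =
     1 / (sqrt (2 * pi * (a\<^sup>2 * d\<^sup>2 / s)) * sqrt (2 * pi * s)) * exp (- (u\<^sup>2 / (2 * (a\<^sup>2 * d\<^sup>2 / s)) + v\<^sup>2 / (2 * s)))"
    unfolding normal_density_def sq by (simp add: exp_add exp_diff exp_minus field_simps)
  also have "\<dots> = normal_density 0 a w * normal_density 0 d (v - b * w)"
    unfolding expo root normal_density_def by (simp add: exp_add exp_diff exp_minus field_simps)
  finally show ?thesis .
qed

lemma unmix_eq_shear:
  assumes "i \<noteq> j"
  shows "unmix i j b c = shear j (\<lambda>x. - b * x i) \<circ> shear i (\<lambda>x. c * x j)"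
  using assms by (auto simp: unmix_def shear_def fun_eq_iff)

text \<open>As a composition of two shears the map preserves Lebesgue measure, so the image law can
  be read off the densities, which \<open>normal_density_mix\<close> matches on the coordinates
  \<open>i\<close> and \<open>j\<close>.\<close>

lemma
  fixes \<sigma> :: "'n::finite \<Rightarrow> real"
  assumes pos: "\<And>k. 0 < \<sigma> k" and ij: "i \<noteq> j" and c: "c = b * (\<sigma> i)\<^sup>2 / (b\<^sup>2 * (\<sigma> i)\<^sup>2 + (\<sigma> j)\<^sup>2)"
  shows measurable_unmix: "unmix i j b c \<in> measurable (noise_space (mixed_sd i j b \<sigma>)) (noise_space \<sigma>)"
    and distr_unmix: "distr (noise_space (mixed_sd i j b \<sigma>)) (noise_space \<sigma>) (unmix i j b c) = noise_space \<sigma>"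
proof -
  let ?S1 = "shear i (\<lambda>x. c * x j) :: ('n \<Rightarrow> real) \<Rightarrow> _" and ?S2 = "shear j (\<lambda>x. - b * x i) :: ('n \<Rightarrow> real) \<Rightarrow> _"
  have m: "?S1 \<in> measurable Leb Leb" "?S2 \<in> measurable Leb Leb"
    by (rule measurable_shear; measurable)+
  have d: "distr Leb Leb ?S1 = Leb" "distr Leb Leb ?S2 = Leb"
    by (rule shear_preserves_Leb; use ij in simp)+
  have u: "unmix i j b c \<in> measurable Leb Leb"
    unfolding unmix_eq_shear[OF ij] using m by (rule measurable_comp)
  have du: "distr Leb Leb (unmix i j b c) = Leb"
    unfolding unmix_eq_shear[OF ij] using distr_distr[OF m(2,1)] d by simp
  show "unmix i j b c \<in> measurable (noise_space (mixed_sd i j b \<sigma>)) (noise_space \<sigma>)"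
    using u by (simp cong: measurable_cong_sets add: sets_noise_space)
  have dens: "gauss_product (mixed_sd i j b \<sigma>) x = gauss_product \<sigma> (unmix i j b c x)" for x
  proof -
    have split: "(\<Prod>k\<in>UNIV. F k) = F i * F j * (\<Prod>k\<in>UNIV - {i, j}. F k)" for F :: "'n \<Rightarrow> real"
    proof -
      have "(\<Prod>k\<in>UNIV. F k) = (\<Prod>k\<in>insert i (insert j (UNIV - {i, j})). F k)"
        by (rule prod.cong) auto
      then show ?thesis using ij by (simp add: mult.assoc)
    qed
    show ?thesis
      unfolding gauss_product_def
      apply (subst (1 2) split)
      using ij normal_density_mix[OF pos[of i] pos[of j], of b "x i" "x j"]
      by (auto simp: mixed_sd_def unmix_def Let_def c intro!: prod.cong arg_cong2[where f="(*)"])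
  qed
  have "distr (noise_space (mixed_sd i j b \<sigma>)) Leb (unmix i j b c) = noise_space \<sigma>"
    unfolding noise_space_density[OF pos] noise_space_density[OF mixed_sd_pos[OF pos]] dens
    using distr_density_preserving[OF u _ du, of "\<lambda>x. ennreal (gauss_product \<sigma> x)"] by simp
  then show "distr (noise_space (mixed_sd i j b \<sigma>)) (noise_space \<sigma>) (unmix i j b c) = noise_space \<sigma>"
    by (simp cong: distr_cong add: sets_noise_space)
qed

section \<open>Continuous functions that agree Lebesgue-almost everywhere\<close>

lemma nonempty_open_Leb_pos:
  fixes U :: "('n::finite \<Rightarrow> real) set"
  assumes "open U" "x \<in> U" "U \<subseteq> N" "N \<in> sets Leb"
  shows "emeasure Leb N \<noteq> 0"
proof -
  obtain X where X: "x \<in> Pi\<^sub>E UNIV X" "\<And>i. open (X i)" "Pi\<^sub>E UNIV X \<subseteq> U"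
    using product_topology_open_contains_basis[of "\<lambda>_::'n. euclidean :: real topology" UNIV U x] assms(1,2)
    by (auto simp: open_fun_def)
  have "emeasure Leb (Pi\<^sub>E UNIV X) = (\<Prod>i\<in>UNIV. emeasure lborel (X i))"
    using X(2) by (intro lborel_product.emeasure_PiM) auto
  also have "\<dots> \<noteq> 0"
  proof -
    have "emeasure lborel (X i) \<noteq> 0" for i
    proof -
      have "x i \<in> X i" using X(1) by auto
      then obtain e where e: "0 < e" "ball (x i) e \<subseteq> X i"
        using X(2) openE by blast
      have "0 < emeasure lborel {x i - e<..<x i + e}" using e(1) by (simp add: ennreal_plus[symmetric] del: ennreal_plus)
      also have "\<dots> \<le> emeasure lborel (X i)"
        using e(2) X(2) by (intro emeasure_mono) (auto simp: ball_eq_greaterThanLessThan)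
      finally show ?thesis by simp
    qed
    then show ?thesis by (simp add: prod_zero_iff)
  qed
  finally have "emeasure Leb (Pi\<^sub>E UNIV X) \<noteq> 0" .
  moreover have "emeasure Leb (Pi\<^sub>E UNIV X) \<le> emeasure Leb N"
    using X(3) assms(3,4) by (intro emeasure_mono) auto
  ultimately show ?thesis by auto
qed

lemma continuous_AE_eq:
  fixes f g :: "('n::finite \<Rightarrow> real) \<Rightarrow> real"
  assumes "continuous_on UNIV f" "continuous_on UNIV g" "AE x in Leb. f x = g x"
  shows "f = g"
proof (rule ccontr)
  assume "f \<noteq> g"
  then obtain x where x: "f x \<noteq> g x" by auto
  obtain N where N: "{x \<in> space Leb. f x \<noteq> g x} \<subseteq> N" "emeasure Leb N = 0" "N \<in> sets Leb"
    using assms(3) by (rule AE_E)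
  have "open {x. f x \<noteq> g x}" using open_Collect_neq[OF assms(1,2)] .
  then show False
    using nonempty_open_Leb_pos[of "{x. f x \<noteq> g x}" x N] x N by (simp add: space_Leb)
qed

subsection \<open>Coordinate sigma-algebras\<close>

lemma sets_coord_alg:
  "sets (coord_alg P C) = sigma_sets (space P) {(\<lambda>x. x i) -` B \<inter> space P | i B. i \<in> C \<and> B \<in> sets borel}"
  unfolding coord_alg_def by (rule sets_measure_of) auto

lemma space_coord_alg: "space (coord_alg P C) = space P"
  by (simp add: coord_alg_def space_measure_of_conv)

lemma measurable_coord_alg:
  assumes "i \<in> C"
  shows "(\<lambda>x. x i) \<in> borel_measurable (coord_alg P C)"
proof (rule measurableI)
  fix B :: "real set" assume "B \<in> sets borel"
  then show "(\<lambda>x. x i) -` B \<inter> space (coord_alg P C) \<in> sets (coord_alg P C)"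
    unfolding space_coord_alg sets_coord_alg using assms by (intro sigma_sets.Basic) auto
qed simp

lemma subalgebra_coord_alg:
  assumes "sets P = sets Rp"
  shows "subalgebra P (coord_alg P C)"
  unfolding subalgebra_def
proof
  show "space (coord_alg P C) = space P" by (rule space_coord_alg)
  have [measurable]: "(\<lambda>x. x i) \<in> borel_measurable P" for i
    using measurable_Rp_component[of i] assms by (simp cong: measurable_cong_sets)
  show "sets (coord_alg P C) \<subseteq> sets P"
    unfolding sets_coord_alg by (rule sets.sigma_sets_subset) auto
qed

lemma coord_alg_local:
  assumes "A \<in> sets (coord_alg P C)" "space P = UNIV" "\<And>k. k \<in> C \<Longrightarrow> x k = y k"
  shows "x \<in> A \<longleftrightarrow> y \<in> A"
  using assms(1) unfolding sets_coord_alg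
  by (induction rule: sigma_sets.induct) (use assms(2,3) in auto)

lemma coord_alg_singleton:
  assumes "U \<in> sets (coord_alg P {j})" "space P = UNIV"
  shows "\<exists>B\<in>sets borel. U = {x. x j \<in> B}"
  using assms(1) unfolding sets_coord_alg
proof (induction rule: sigma_sets.induct)
  case (Basic a)
  then show ?case using assms(2) by auto
next
  case Empty
  then show ?case by (intro bexI[of _ "{}"]) auto
next
  case (Compl a)
  then obtain B where "B \<in> sets borel" "a = {x. x j \<in> B}" by blast
  then show ?case using assms(2) by (intro bexI[of _ "- B"]) auto
next
  case (Union a)
  then have "\<forall>i. \<exists>B. B \<in> sets borel \<and> a i = {x. x j \<in> B}" by blast
  then obtain B where "\<And>i::nat. B i \<in> sets borel \<and> a i = {x. x j \<in> B i}" by metis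
  then show ?case by (intro bexI[of _ "\<Union>i. B i"]) auto
qed

subsection \<open>Twice differentiable functions\<close>

lemma C2_DERIV: "C2 g \<Longrightarrow> (g has_real_derivative deriv g x) (at x)"
  by (auto simp: C2_def DERIV_deriv_iff_real_differentiable)

lemma C2_DERIV2: "C2 g \<Longrightarrow> (deriv g has_real_derivative deriv (deriv g) x) (at x)"
  by (auto simp: C2_def DERIV_deriv_iff_real_differentiable)

lemma C2_continuous_on: "C2 g \<Longrightarrow> continuous_on S g"
  by (meson C2_DERIV DERIV_isCont continuous_at_imp_continuous_on)

lemma C2_measurable: "C2 g \<Longrightarrow> g \<in> borel_measurable borel"
  by (simp add: C2_continuous_on borel_measurable_continuous_onI)

lemma C2_linear_combination:
  assumes "C2 g" "C2 h"
  shows "C2 (\<lambda>x. a * g x + b * h x)"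
proof -
  have 1: "((\<lambda>x. a * g x + b * h x) has_real_derivative a * deriv g x + b * deriv h x) (at x)" for x
    by (auto intro!: derivative_eq_intros C2_DERIV assms)
  then have d1: "deriv (\<lambda>x. a * g x + b * h x) = (\<lambda>x. a * deriv g x + b * deriv h x)"
    by (auto intro: DERIV_imp_deriv)
  have 2: "((\<lambda>x. a * deriv g x + b * deriv h x) has_real_derivative
      a * deriv (deriv g) x + b * deriv (deriv h) x) (at x)" for x
    by (auto intro!: derivative_eq_intros C2_DERIV2 assms)
  then have d2: "deriv (\<lambda>x. a * deriv g x + b * deriv h x) = (\<lambda>x. a * deriv (deriv g) x + b * deriv (deriv h) x)"
    by (auto intro: DERIV_imp_deriv)
  show ?thesis
    unfolding C2_def d1 d2
    using 1 2 assms unfolding C2_def real_differentiable_def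
    by (auto intro!: continuous_intros)
qed

lemma C2_affine: "C2 (\<lambda>x. a * x + b)"
proof -
  have d1: "deriv (\<lambda>x::real. a * x + b) = (\<lambda>x. a)"
    by (rule ext, rule DERIV_imp_deriv) (auto intro!: derivative_eq_intros)
  show ?thesis unfolding C2_def d1 by (auto intro!: derivative_intros)
qed

lemma C2_affine_if_deriv2_zero:
  assumes "C2 g" "\<And>t. deriv (deriv g) t = 0"
  obtains b d where "g = (\<lambda>x. b * x + d)"
proof -
  have "(deriv g has_real_derivative 0) (at t)" for t
    using C2_DERIV2[OF assms(1), of t] assms(2) by simp
  then have c: "deriv g t = deriv g 0" for t
    using DERIV_isconst_all by blast
  have "((\<lambda>x. g x - deriv g 0 * x) has_real_derivative 0) (at t)" for t
    using C2_DERIV[OF assms(1), of t] c[of t] by (auto intro!: derivative_eq_intros)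
  then have eq: "g t - deriv g 0 * t = g 0 - deriv g 0 * 0" for t
    using DERIV_isconst_all[of "\<lambda>x. g x - deriv g 0 * x" t 0] by blast
  have "g t = deriv g 0 * t + g 0" for t using eq[of t] by linarith
  then have "g = (\<lambda>t. deriv g 0 * t + g 0)" by (rule ext)
  then show ?thesis by (rule that)
qed

subsection \<open>Additive structural equation models\<close>

lemma acyclic_induct [consumes 1, case_names step]:
  fixes E :: "('n::finite \<times> 'n) set"
  assumes "acyclic E" "\<And>j. (\<And>i. (i, j) \<in> E \<Longrightarrow> Q i) \<Longrightarrow> Q j"
  shows "Q j"
proof -
  have "wf E" using assms(1) by (simp add: finite_acyclic_wf)
  then show ?thesis by (induction j rule: wf_induct_rule) (use assms(2) in blast)
qed

definition residual :: "('n \<times> 'n) set \<Rightarrow> ('n \<Rightarrow> real) \<Rightarrow> ('n \<Rightarrow> 'n \<Rightarrow> real \<Rightarrow> real) \<Rightarrow>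
    ('n \<Rightarrow> real) \<Rightarrow> 'n \<Rightarrow> real" where
  "residual E \<mu> f x j = x j - \<mu> j - (\<Sum>i\<in>pa E j. f j i (x i))"

text \<open>A PLSEM except that the functions \<open>f j i\<close> may vanish identically.\<close>

locale additive_sem =
  fixes E :: "('n::finite \<times> 'n) set" and \<mu> :: "'n \<Rightarrow> real" and f :: "'n \<Rightarrow> 'n \<Rightarrow> real \<Rightarrow> real"
    and \<sigma> :: "'n \<Rightarrow> real" and X :: "('n \<Rightarrow> real) \<Rightarrow> 'n \<Rightarrow> real"
  assumes acyclic: "acyclic E"
    and sd_pos: "\<And>j. 0 < \<sigma> j"
    and C2_f: "\<And>j i. i \<in> pa E j \<Longrightarrow> C2 (f j i)"
    and integrable_f: "\<And>j i. i \<in> pa E j \<Longrightarrow> integrable (noise_space \<sigma>) (\<lambda>\<omega>. f j i (X \<omega> i))"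
    and mean_f: "\<And>j i. i \<in> pa E j \<Longrightarrow> (\<integral>\<omega>. f j i (X \<omega> i) \<partial>noise_space \<sigma>) = 0"
    and X_measurable: "X \<in> measurable (noise_space \<sigma>) Rp"
    and X_eq: "\<And>\<omega> j. X \<omega> j = \<mu> j + (\<Sum>i\<in>pa E j. f j i (X \<omega> i)) + \<omega> j"

lemma generated_by_PLSEM_iff:
  assumes "acyclic E"
  shows "generated_by_PLSEM P E \<longleftrightarrow>
    (\<exists>\<mu> f \<sigma> X. additive_sem E \<mu> f \<sigma> X \<and> (\<forall>j. \<forall>i\<in>pa E j. f j i \<noteq> (\<lambda>_. 0)) \<and>
      P = distr (noise_space \<sigma>) Rp X)"
proof
  assume "generated_by_PLSEM P E"
  then obtain \<mu> f \<sigma> X where pos: "\<forall>j. \<sigma> j > 0"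
    and f: "\<forall>j. \<forall>i\<in>pa E j. C2 (f j i) \<and> f j i \<noteq> (\<lambda>_. 0) \<and>
             integrable (noise_space \<sigma>) (\<lambda>\<omega>. f j i (X \<omega> i)) \<and>
             (\<integral>\<omega>. f j i (X \<omega> i) \<partial>noise_space \<sigma>) = 0"
    and X: "X \<in> measurable (noise_space \<sigma>) Rp"
    and eq: "\<forall>\<omega> j. X \<omega> j = \<mu> j + (\<Sum>i\<in>pa E j. f j i (X \<omega> i)) + \<omega> j"
    and P: "P = distr (noise_space \<sigma>) Rp X"
    unfolding generated_by_PLSEM_def by (elim exE conjE)
  have "additive_sem E \<mu> f \<sigma> X"
    by (rule additive_sem.intro[OF assms pos[rule_format] _ _ _ X eq[rule_format]]) (use f in blast)+
  then show "\<exists>\<mu> f \<sigma> X. additive_sem E \<mu> f \<sigma> X \<and> (\<forall>j. \<forall>i\<in>pa E j. f j i \<noteq> (\<lambda>_. 0)) \<and>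
      P = distr (noise_space \<sigma>) Rp X"
    using f P by blast
next
  assume "\<exists>\<mu> f \<sigma> X. additive_sem E \<mu> f \<sigma> X \<and> (\<forall>j. \<forall>i\<in>pa E j. f j i \<noteq> (\<lambda>_. 0)) \<and>
      P = distr (noise_space \<sigma>) Rp X"
  then obtain \<mu> f \<sigma> X where sem: "additive_sem E \<mu> f \<sigma> X"
    and f: "\<forall>j. \<forall>i\<in>pa E j. f j i \<noteq> (\<lambda>_. 0)" and P: "P = distr (noise_space \<sigma>) Rp X" by blast
  show "generated_by_PLSEM P E"
    unfolding generated_by_PLSEM_def
    by (intro exI[of _ \<mu>] exI[of _ f] exI[of _ \<sigma>] exI[of _ X] conjI allI ballI P
      additive_sem.sd_pos[OF sem] additive_sem.C2_f[OF sem] additive_sem.integrable_f[OF sem]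
      additive_sem.mean_f[OF sem] additive_sem.X_measurable[OF sem] additive_sem.X_eq[OF sem])
      (use f in auto)
qed

context additive_sem
begin

abbreviation "N \<equiv> noise_space \<sigma>"
abbreviation "law \<equiv> distr (noise_space \<sigma>) Rp X"
abbreviation "res \<equiv> residual E \<mu> f"

sublocale N: prob_space N
  using sd_pos by (rule prob_space_noise)

lemma residual_X: "res (X \<omega>) = \<omega>"
proof
  fix j show "res (X \<omega>) j = \<omega> j" using X_eq[of \<omega> j] by (simp add: residual_def)
qed

lemma X_residual: "X (res x) = x"
proof
  fix j show "X (res x) j = x j"
    using acyclic
  proof (induction j rule: acyclic_induct)
    case (step j)
    then have "(\<Sum>i\<in>pa E j. f j i (X (res x) i)) = (\<Sum>i\<in>pa E j. f j i (x i))"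
      by (intro sum.cong) (auto simp: pa_def)
    then show ?case by (subst X_eq) (simp add: residual_def)
  qed
qed

lemma continuous_on_residual: "continuous_on S (\<lambda>x. res x j)"
proof -
  have "continuous_on S (\<lambda>x. x i)" for i
    by (rule continuous_on_subset[OF continuous_on_product_coordinates]) simp
  moreover from this have "continuous_on S (\<lambda>x. f j i (x i))" if "i \<in> pa E j" for i
    using C2_continuous_on[OF C2_f[OF that], of UNIV] continuous_on_compose2 by blast
  ultimately show ?thesis
    unfolding residual_def by (intro continuous_intros) auto
qed

lemma measurable_residual_coord: "(\<lambda>x. res x j) \<in> borel_measurable Leb"
proof -
  have "(\<lambda>x. f j i (x i)) \<in> borel_measurable Leb" if "i \<in> pa E j" for i
    by (rule measurable_compose[OF measurable_Leb_component C2_measurable[OF C2_f[OF that]]])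
  then show ?thesis unfolding residual_def
    by (intro borel_measurable_diff borel_measurable_sum borel_measurable_const measurable_Leb_component)
qed

lemma measurable_residual: "res \<in> measurable Leb Leb"
  by (rule measurable_PiM_single') (use measurable_residual_coord in \<open>auto simp: space_PiM\<close>)

text \<open>The residual map is triangular with unit diagonal. \<open>G K\<close> replaces only the
  coordinates in \<open>K\<close> by their residuals; since \<open>K\<close> is closed under
  children, the parents of the next vertex \<open>k\<close> still carry their original values, and
  passing to \<open>insert k K\<close> is a shear.\<close>

lemma residual_preserves_Leb: "distr Leb Leb res = Leb"
proof -
  define G where "G K x = (\<lambda>j. if j \<in> K then res x j else x j)" for K x
  have "G K \<in> measurable Leb Leb \<and> distr Leb Leb (G K) = Leb" if "upclosed E K" for K
    using acyclic that
  proof (induction K rule: upclosed_induct)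
    case empty
    then show ?case by (simp add: G_def distr_id[unfolded id_def])
  next
    case (insert K k)
    define h where "h x = - \<mu> k - (\<Sum>i\<in>pa E k. f k i (x i))" for x
    have paK: "pa E k \<inter> insert k K = {}"
      using insert(1,2) acyclic_irrefl[OF acyclic] by (auto simp: pa_def upclosed_def)
    have h: "h \<in> borel_measurable Leb"
      unfolding h_def
      by (intro borel_measurable_diff borel_measurable_sum borel_measurable_const
        measurable_compose[OF measurable_Leb_component C2_measurable[OF C2_f]]) auto
    have hk: "h (x(k := t)) = h x" for x t
    proof -
      have "(\<Sum>i\<in>pa E k. f k i ((x(k := t)) i)) = (\<Sum>i\<in>pa E k. f k i (x i))"
        by (rule sum.cong) (use paK in auto)
      then show ?thesis by (simp only: h_def)
    qed
    have "G (insert k K) x = shear k h (G K x)" for x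
    proof -
      have "(\<Sum>i\<in>pa E k. f k i (G K x i)) = (\<Sum>i\<in>pa E k. f k i (x i))"
        by (rule sum.cong) (use paK in \<open>auto simp: G_def\<close>)
      then have "h (G K x) = h x" by (simp only: h_def)
      then show ?thesis using insert(2) by (auto simp: G_def shear_def residual_def h_def fun_eq_iff)
    qed
    then have "G (insert k K) = shear k h \<circ> G K" by (simp add: fun_eq_iff)
    moreover have "shear k h \<circ> G K \<in> measurable Leb Leb"
      using measurable_comp[OF conjunct1[OF insert(4)] measurable_shear[OF h]] .
    moreover have "distr Leb Leb (shear k h \<circ> G K) = Leb"
      using distr_distr[OF measurable_shear[OF h] conjunct1[OF insert(4)]] insert(4) shear_preserves_Leb[OF h hk]
      by simp
    ultimately show ?case by (simp only:)
  qed
  moreover have "G UNIV = res" by (simp add: G_def fun_eq_iff)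
  ultimately show ?thesis using upclosed_UNIV[of E] by metis
qed

lemma measurable_X: "X \<in> measurable Leb Leb"
  using X_measurable by (simp cong: measurable_cong_sets add: sets_noise_space sets_Rp)

lemma X_preserves_Leb: "distr Leb Leb X = Leb"
proof -
  have "distr Leb Leb X = distr (distr Leb Leb res) Leb X" by (simp add: residual_preserves_Leb)
  also have "\<dots> = distr Leb Leb (X \<circ> res)" by (rule distr_distr[OF measurable_X measurable_residual])
  also have "\<dots> = Leb" by (simp add: o_def X_residual distr_id[unfolded id_def])
  finally show ?thesis .
qed

lemma law_density: "law = density Leb (\<lambda>x. ennreal (gauss_product \<sigma> (res x)))"
proof -
  have g: "(\<lambda>x. ennreal (gauss_product \<sigma> (res x))) \<in> borel_measurable Leb"
    using measurable_compose[OF measurable_residual gauss_product_measurable[of \<sigma>]] by measurable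
  have "law = distr (noise_space \<sigma>) Leb X" by (rule distr_cong) (simp_all add: sets_Rp)
  also have "\<dots> = distr (density Leb (\<lambda>x. ennreal (gauss_product \<sigma> (res (X x))))) Leb X"
    by (simp add: residual_X noise_space_density[OF sd_pos])
  also have "\<dots> = density Leb (\<lambda>x. ennreal (gauss_product \<sigma> (res x)))"
    by (rule distr_density_preserving[OF measurable_X g X_preserves_Leb])
  finally show ?thesis .
qed

lemma integrable_noise: "integrable N (\<lambda>\<omega>. \<omega> j)"
  and mean_noise: "(\<integral>\<omega>. \<omega> j \<partial>N) = 0"
proof -
  let ?\<nu> = "density lborel (normal_density 0 (\<sigma> j))"
  have d: "distr N ?\<nu> (\<lambda>\<omega>. \<omega> j) = ?\<nu>"
    unfolding noise_space_def by (rule distr_PiM_component) (auto intro: prob_space_normal_density sd_pos)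
  have m: "(\<lambda>\<omega>. \<omega> j) \<in> measurable N ?\<nu>"
    unfolding noise_space_def by (rule measurable_component_singleton) simp
  have "integrable ?\<nu> (\<lambda>x. x)" "(\<integral>x. x \<partial>?\<nu>) = 0"
    using integrable_normal_moment_nz_1[OF sd_pos, of 0 j] integral_normal_moment_nz_1[OF sd_pos, of 0 j]
    by (simp_all add: integrable_density integral_density)
  then have 1: "integrable (distr N ?\<nu> (\<lambda>\<omega>. \<omega> j)) (\<lambda>x. x)" "(\<integral>x. x \<partial>distr N ?\<nu> (\<lambda>\<omega>. \<omega> j)) = 0"
    by (simp_all only: d)
  have id: "(\<lambda>x. x) \<in> borel_measurable ?\<nu>" by simp
  show "integrable N (\<lambda>\<omega>. \<omega> j)"
    using integrable_distr_eq[OF m id] 1(1) by blast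
  show "(\<integral>\<omega>. \<omega> j \<partial>N) = 0"
    by (rule trans[OF integral_distr[OF m id, symmetric] 1(2)])
qed

text \<open>Because the functions are centred, \<open>\<mu>\<close> is the vector of means. This
  later fixes the additive constants of a linear edge function and of its reversal.\<close>

lemma integrable_X: "integrable N (\<lambda>\<omega>. X \<omega> j)"
  and mean_X: "(\<integral>\<omega>. X \<omega> j \<partial>N) = \<mu> j"
proof -
  have i: "integrable N (\<lambda>\<omega>. \<Sum>i\<in>pa E j. f j i (X \<omega> i))"
    and e: "(\<integral>\<omega>. (\<Sum>i\<in>pa E j. f j i (X \<omega> i)) \<partial>N) = 0"
    using integrable_f mean_f by (simp_all add: integral_sum)
  have *: "(\<lambda>\<omega>. X \<omega> j) = (\<lambda>\<omega>. \<mu> j + (\<Sum>i\<in>pa E j. f j i (X \<omega> i)) + \<omega> j)"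
    by (rule ext) (rule X_eq)
  have "integrable N (\<lambda>\<omega>. \<mu> j + (\<Sum>i\<in>pa E j. f j i (X \<omega> i)) + \<omega> j)"
    using i integrable_noise[of j] by (intro Bochner_Integration.integrable_add) simp_all
  then show "integrable N (\<lambda>\<omega>. X \<omega> j)" by (simp only: *[symmetric])
  have "(\<integral>\<omega>. \<mu> j + (\<Sum>i\<in>pa E j. f j i (X \<omega> i)) + \<omega> j \<partial>N) = \<mu> j"
    using i e integrable_noise[of j] mean_noise[of j] N.prob_space by simp
  then show "(\<integral>\<omega>. X \<omega> j \<partial>N) = \<mu> j" by (simp only: *[symmetric])
qed

subsection \<open>Vanishing functions give conditional independences\<close>

lemma X_upd:
  assumes "(j, k) \<notin> E\<^sup>*"
  shows "X (w(j := t)) k = X w k"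
proof -
  have "(j, k) \<notin> E\<^sup>* \<longrightarrow> X (w(j := t)) k = X w k"
    using acyclic
  proof (induction k rule: acyclic_induct)
    case (step k)
    show ?case
    proof
      assume jk: "(j, k) \<notin> E\<^sup>*"
      have "k \<noteq> j" using jk by (metis rtrancl.rtrancl_refl)
      have "f k i (X (w(j := t)) i) = f k i (X w i)" if "i \<in> pa E k" for i
      proof -
        have i: "(i, k) \<in> E" using that by (simp add: pa_def)
        then have ji: "(j, i) \<notin> E\<^sup>*" using jk by (meson rtrancl.rtrancl_into_rtrancl)
        show ?thesis by (rule arg_cong[OF mp[OF step[OF i] ji]])
      qed
      then have "(\<Sum>i\<in>pa E k. f k i (X (w(j := t)) i)) = (\<Sum>i\<in>pa E k. f k i (X w i))"
        by (rule sum.cong[OF refl])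
      moreover have "(w(j := t)) k = w k" using \<open>k \<noteq> j\<close> by simp
      ultimately have "\<mu> k + (\<Sum>i\<in>pa E k. f k i (X (w(j := t)) i)) + (w(j := t)) k =
          \<mu> k + (\<Sum>i\<in>pa E k. f k i (X w i)) + w k" by (simp only:)
      then show "X (w(j := t)) k = X w k" unfolding X_eq[symmetric] .
    qed
  qed
  then show ?thesis using assms by blast
qed

lemma X_upd_parent: "k \<in> pa E j \<Longrightarrow> X (w(j := t)) k = X w k"
proof (rule X_upd)
  assume "k \<in> pa E j"
  then have "(k, j) \<in> E" by (simp add: pa_def)
  then show "(j, k) \<notin> E\<^sup>*" using acyclic by (meson acyclic_def rtrancl_into_trancl1)
qed

section \<open>The conditional law of a vertex given its parents\<close>

definition structural_mean :: "'n \<Rightarrow> ('n \<Rightarrow> real) \<Rightarrow> real" where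
  "structural_mean j x = \<mu> j + (\<Sum>i\<in>pa E j. f j i (x i))"

text \<open>This is the conditional probability that coordinate \<open>j\<close> falls into
  \<open>B\<close> when its structural mean equals \<open>s\<close>.\<close>

definition noise_prob :: "'n \<Rightarrow> real set \<Rightarrow> real \<Rightarrow> real" where
  "noise_prob j B s = (\<integral>t. indicator B (s + t) \<partial>density lborel (normal_density 0 (\<sigma> j)))"

lemma noise_prob_measurable:
  assumes [measurable]: "B \<in> sets borel"
  shows "noise_prob j B \<in> borel_measurable borel"
proof -
  interpret prob_space "density lborel (normal_density 0 (\<sigma> j))"
    by (rule prob_space_normal_density[OF sd_pos])
  show ?thesis unfolding noise_prob_def by measurable
qed

lemma noise_prob_bounded:
  assumes [measurable]: "B \<in> sets borel"
  shows "\<bar>noise_prob j B s\<bar> \<le> 1"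
proof -
  interpret prob_space "density lborel (normal_density 0 (\<sigma> j))"
    by (rule prob_space_normal_density[OF sd_pos])
  have "noise_prob j B s = (\<integral>t. indicator ((\<lambda>t. s + t) -` B) t \<partial>density lborel (normal_density 0 (\<sigma> j)))"
    by (simp add: noise_prob_def indicator_def vimage_def)
  also have "\<dots> = prob ((\<lambda>t. s + t) -` B)" by simp
  finally show ?thesis by simp
qed

lemma noise_integral_insert:
  fixes F :: "('n \<Rightarrow> real) \<Rightarrow> real"
  assumes "integrable N F"
  shows "(\<integral>\<omega>. F \<omega> \<partial>N) = (\<integral>x. (\<integral>y. F (x(j := y)) \<partial>density lborel (normal_density 0 (\<sigma> j)))
     \<partial>PiM (UNIV - {j}) (\<lambda>j. density lborel (normal_density 0 (\<sigma> j))))"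
proof -
  interpret p: product_sigma_finite "\<lambda>j. density lborel (normal_density 0 (\<sigma> j))"
    unfolding product_sigma_finite_def
    by (intro allI prob_space_imp_sigma_finite prob_space_normal_density sd_pos)
  have "insert j (UNIV - {j}) = UNIV" by auto
  then show ?thesis
    using p.product_integral_insert[of "UNIV - {j}" j F] assms by (simp add: noise_space_def)
qed

lemma measurable_structural_mean:
  assumes "\<And>i. i \<in> pa E j \<Longrightarrow> (\<lambda>x. f j i (x i)) \<in> borel_measurable M"
  shows "structural_mean j \<in> borel_measurable M"
  unfolding structural_mean_def using assms by (intro borel_measurable_add borel_measurable_sum) auto

text \<open>The parents of \<open>j\<close> do not react to the noise of \<open>j\<close>. With all
  other noises fixed, the structural mean and membership in \<open>W\<close> are therefore constant,
  and Fubini integrates the noise of \<open>j\<close> out.\<close>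

lemma law_conditional:
  assumes B [measurable]: "B \<in> sets borel" and W [measurable]: "W \<in> sets Rp"
    and loc: "\<And>x y. (\<And>k. k \<in> pa E j \<Longrightarrow> x k = y k) \<Longrightarrow> x \<in> W \<longleftrightarrow> y \<in> W"
  shows "(\<integral>x. indicator B (x j) * indicator W x \<partial>law) =
    (\<integral>x. noise_prob j B (structural_mean j x) * indicator W x \<partial>law)"
proof -
  note [measurable] = X_measurable noise_prob_measurable[OF B]
  have [measurable]: "structural_mean j \<in> borel_measurable Rp"
    by (rule measurable_structural_mean)
      (rule measurable_compose[OF measurable_Rp_component C2_measurable[OF C2_f]])
  let ?\<nu> = "density lborel (normal_density 0 (\<sigma> j))"
  interpret \<nu>: prob_space ?\<nu> by (rule prob_space_normal_density[OF sd_pos])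
  let ?m = "\<lambda>\<omega>. structural_mean j (X \<omega>)"
  have Xj: "X \<omega> j = ?m \<omega> + \<omega> j" for \<omega> using X_eq[of \<omega> j] by (simp add: structural_mean_def)
  have m_upd: "?m (w(j := t)) = ?m w" for w t
    unfolding structural_mean_def by (simp add: X_upd_parent)
  have W_upd: "indicator W (X (w(j := t))) = (indicator W (X w) :: real)" for w t
    using loc[of "X (w(j := t))" "X w"] X_upd_parent by (simp add: indicator_def)
  have "(\<integral>x. indicator B (x j) * indicator W x \<partial>law) = (\<integral>\<omega>. indicator B (X \<omega> j) * indicator W (X \<omega>) \<partial>N :: real)"
    by (rule integral_distr) measurable
  also have "\<dots> = (\<integral>x. (\<integral>y. indicator B (?m x + y) * indicator W (X x) \<partial>?\<nu>)
     \<partial>PiM (UNIV - {j}) (\<lambda>j. density lborel (normal_density 0 (\<sigma> j))))"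
  proof -
    have "integrable N (\<lambda>\<omega>. indicator B (X \<omega> j) * indicator W (X \<omega>) :: real)"
      by (rule N.integrable_const_bound[where B = 1]) (auto simp: indicator_def)
    from noise_integral_insert[OF this, of j] show ?thesis
      by (simp add: Xj m_upd W_upd)
  qed
  also have "\<dots> = (\<integral>x. (\<integral>y. noise_prob j B (?m x) * indicator W (X x) \<partial>?\<nu>)
     \<partial>PiM (UNIV - {j}) (\<lambda>j. density lborel (normal_density 0 (\<sigma> j))))"
    using \<nu>.prob_space by (simp add: noise_prob_def)
  also have "\<dots> = (\<integral>\<omega>. noise_prob j B (?m \<omega>) * indicator W (X \<omega>) \<partial>N)"
  proof -
    have "integrable N (\<lambda>\<omega>. noise_prob j B (?m \<omega>) * indicator W (X \<omega>))"
      using noise_prob_bounded[OF B]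
      by (intro N.integrable_const_bound[where B = 1]) (auto simp: indicator_def)
    from noise_integral_insert[OF this, of j] show ?thesis
      by (simp add: m_upd W_upd)
  qed
  also have "\<dots> = (\<integral>x. noise_prob j B (structural_mean j x) * indicator W x \<partial>law)"
    by (rule integral_distr[symmetric]) measurable
  finally show ?thesis .
qed

text \<open>If the function of \<open>z\<close> vanishes, the structural mean of \<open>j\<close> is
  measurable with respect to the other parents alone. The conditional probability \<open>q\<close>
  of \<open>U\<close> given all parents is then already a version of the one given \<open>C\<close>,
  and it factors out of the conditional probability of \<open>U \<inter> V\<close>.\<close>

lemma cond_indep_if_vanishing:
  assumes z: "z \<in> pa E j" and fz: "f j z = (\<lambda>_. 0)"
  shows "cond_indep law {j} {z} (pa E j - {z})"
  unfolding cond_indep_def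
proof (intro ballI)
  define C where "C = pa E j - {z}"
  define F where "F = coord_alg law C"
  have sp: "space law = UNIV" by (simp add: space_Rp)
  have st: "sets law = sets Rp" by simp
  interpret law: prob_space law by (rule N.prob_space_distr[OF X_measurable])
  interpret finite_measure_subalgebra law F
    unfolding F_def by standard (rule subalgebra_coord_alg[OF st])
  fix U V assume "U \<in> sets (coord_alg law {j})" "V \<in> sets (coord_alg law {z})"
  then obtain B B' where B [measurable]: "B \<in> sets borel" and U: "U = {x. x j \<in> B}"
    and B' [measurable]: "B' \<in> sets borel" and V: "V = {x. x z \<in> B'}"
    using coord_alg_singleton[OF _ sp] by metis
  have F_sub: "A \<in> sets F \<Longrightarrow> A \<in> sets Rp" for A
    using subalg by (auto simp: subalgebra_def)
  have [measurable]: "U \<in> sets Rp" "V \<in> sets Rp"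
    using measurable_sets[OF measurable_Rp_component[of j] B] measurable_sets[OF measurable_Rp_component[of z] B']
    by (simp_all add: U V vimage_def space_Rp)
  define q where "q x = noise_prob j B (structural_mean j x)" for x
  have "structural_mean j \<in> borel_measurable F"
  proof (rule measurable_structural_mean)
    fix i assume i: "i \<in> pa E j"
    show "(\<lambda>x. f j i (x i)) \<in> borel_measurable F"
    proof (cases "i = z")
      case True
      then show ?thesis using fz by simp
    next
      case False
      then have "i \<in> C" using i by (simp add: C_def)
      from measurable_compose[OF measurable_coord_alg[OF this] C2_measurable[OF C2_f[OF i]]]
      show ?thesis by (simp add: F_def)
    qed
  qed
  then have qF [measurable]: "q \<in> borel_measurable F"
    unfolding q_def by (rule measurable_compose[OF _ noise_prob_measurable[OF B]])
  have q_law [measurable]: "q \<in> borel_measurable law"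
    by (rule measurable_from_subalg[OF subalg qF])
  have q1: "\<bar>q x\<bar> \<le> 1" for x unfolding q_def by (rule noise_prob_bounded[OF B])
  \<comment> \<open>Taking \<open>W\<close> to be everything gives the conditional probability of
    \<open>U\<close>; taking \<open>W = V\<close> gives that of the intersection. Both test sets
    depend only on parents of \<open>j\<close>, as \<open>z\<close> is one of them.\<close>
  have key: "(\<integral>x. indicator U x * indicator (A \<inter> W) x \<partial>law) = (\<integral>x. q x * indicator (A \<inter> W) x \<partial>law)"
    if A: "A \<in> sets F" and W: "W = UNIV \<or> W = V" for A W
  proof -
    have AW: "A \<inter> W \<in> sets Rp" using F_sub[OF A] W by auto
    have loc: "x \<in> A \<inter> W \<longleftrightarrow> y \<in> A \<inter> W" if "\<And>k. k \<in> pa E j \<Longrightarrow> x k = y k" for x y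
      using coord_alg_local[OF A[unfolded F_def] sp, of x y] that W z by (auto simp: C_def V)
    have "indicator U x = (indicator B (x j) :: real)" for x by (simp add: U indicator_def)
    then show ?thesis using law_conditional[OF B AW loc] by (simp add: q_def)
  qed
  define g where "g = real_cond_exp law F (indicator V)"
  have gF [measurable]: "g \<in> borel_measurable F" unfolding g_def by simp
  have [measurable]: "g \<in> borel_measurable law" unfolding g_def by simp
  have intI: "integrable law (\<lambda>x. q x * indicator V x)" "integrable law q"
    "integrable law (indicator U :: _ \<Rightarrow> real)" "integrable law (indicator V :: _ \<Rightarrow> real)"
    "integrable law (indicator (U \<inter> V) :: _ \<Rightarrow> real)"
    by (rule law.integrable_const_bound[where B = 1]; use q1 in \<open>auto simp: indicator_def\<close>)+
  have 1: "AE x in law. real_cond_exp law F (indicator U) x = q x"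
  proof (rule real_cond_exp_charact)
    fix A assume A: "A \<in> sets F"
    from key[OF A, of UNIV] show "(\<integral>x\<in>A. indicator U x \<partial>law) = (\<integral>x\<in>A. q x \<partial>law)"
      by (simp add: set_lebesgue_integral_def mult.commute)
  qed (use intI qF in auto)
  have 2: "AE x in law. real_cond_exp law F (indicator (U \<inter> V)) x = q x * g x"
  proof (rule real_cond_exp_charact)
    show qg: "integrable law (\<lambda>x. q x * g x)"
      unfolding g_def by (rule real_cond_exp_intg(1)) (use intI in auto)
    fix A assume A: "A \<in> sets F"
    then have [measurable]: "A \<in> sets F" "A \<in> sets law" using F_sub[OF A] by auto
    have i: "integrable law (\<lambda>x. (indicator A x * q x) * indicator V x)"
      by (rule law.integrable_const_bound[where B = 1]) (use q1 in \<open>auto simp: indicator_def\<close>)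
    have "(\<integral>x\<in>A. indicator (U \<inter> V) x \<partial>law) = (\<integral>x. indicator U x * indicator (A \<inter> V) x \<partial>law :: real)"
      unfolding set_lebesgue_integral_def
      by (rule Bochner_Integration.integral_cong) (auto simp: indicator_def)
    also have "\<dots> = (\<integral>x. q x * indicator (A \<inter> V) x \<partial>law)" using key[OF A, of V] by simp
    also have "\<dots> = (\<integral>x. (indicator A x * q x) * indicator V x \<partial>law)"
      by (rule Bochner_Integration.integral_cong) (auto simp: indicator_def)
    also have "\<dots> = (\<integral>x. (indicator A x * q x) * g x \<partial>law)"
      unfolding g_def by (rule real_cond_exp_intg(2)[symmetric]) (use i in auto)
    also have "\<dots> = (\<integral>x\<in>A. q x * g x \<partial>law)"
      by (simp add: set_lebesgue_integral_def mult.assoc)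
    finally show "(\<integral>x\<in>A. indicator (U \<inter> V) x \<partial>law) = (\<integral>x\<in>A. q x * g x \<partial>law)" .
  qed (use intI qF gF in auto)
  show "AE x in law. real_cond_exp law (coord_alg law (pa E j - {z})) (indicator (U \<inter> V)) x =
      real_cond_exp law (coord_alg law (pa E j - {z})) (indicator U) x *
      real_cond_exp law (coord_alg law (pa E j - {z})) (indicator V) x"
    using 1 2 unfolding g_def F_def C_def by eventually_elim simp
qed

end

subsection \<open>The density determines a quadratic form\<close>

lemma gauss_product_exp:
  fixes \<sigma> :: "'n::finite \<Rightarrow> real"
  assumes "\<And>j. 0 < \<sigma> j"
  shows "gauss_product \<sigma> y = (\<Prod>j\<in>UNIV. 1 / sqrt (2 * pi * (\<sigma> j)\<^sup>2)) * exp (- (\<Sum>j\<in>UNIV. (y j)\<^sup>2 / (\<sigma> j)\<^sup>2) / 2)"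
proof -
  have "gauss_product \<sigma> y = (\<Prod>j\<in>UNIV. 1 / sqrt (2 * pi * (\<sigma> j)\<^sup>2)) * (\<Prod>j\<in>UNIV. exp (- ((y j)\<^sup>2 / (\<sigma> j)\<^sup>2) / 2))"
    unfolding gauss_product_def normal_density_def prod.distrib[symmetric] by (simp add: field_simps)
  also have "(\<Prod>j\<in>UNIV. exp (- ((y j)\<^sup>2 / (\<sigma> j)\<^sup>2) / 2)) = exp (- (\<Sum>j\<in>UNIV. (y j)\<^sup>2 / (\<sigma> j)\<^sup>2) / 2)"
    by (simp add: exp_sum[symmetric] sum_negf sum_divide_distrib)
  finally show ?thesis .
qed

text \<open>The densities agree almost everywhere and are continuous, so they agree at every point,
  where derivatives can be taken later. After the logarithm, \<open>c\<close> collects the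
  normalising constants.\<close>

lemma same_law_quadratic:
  fixes E E' :: "('n::finite \<times> 'n) set"
  assumes "additive_sem E \<mu> f \<sigma> X" "additive_sem E' \<mu>' f' \<sigma>' X'"
    and law: "distr (noise_space \<sigma>) Rp X = distr (noise_space \<sigma>') Rp X'"
  obtains c where "\<And>x. (\<Sum>j\<in>UNIV. (residual E \<mu> f x j)\<^sup>2 / (\<sigma> j)\<^sup>2) =
    (\<Sum>j\<in>UNIV. (residual E' \<mu>' f' x j)\<^sup>2 / (\<sigma>' j)\<^sup>2) + c"
proof -
  interpret S: additive_sem E \<mu> f \<sigma> X by fact
  interpret S': additive_sem E' \<mu>' f' \<sigma>' X' by fact
  let ?p = "\<lambda>x. gauss_product \<sigma> (S.res x)" and ?p' = "\<lambda>x. gauss_product \<sigma>' (S'.res x)"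
  have [measurable]: "?p \<in> borel_measurable Leb" "?p' \<in> borel_measurable Leb"
    using measurable_compose[OF S.measurable_residual gauss_product_measurable]
      measurable_compose[OF S'.measurable_residual gauss_product_measurable] by auto
  interpret L: sigma_finite_measure "Leb :: ('n \<Rightarrow> real) measure"
    by (rule lborel_product.sigma_finite) simp
  have nonneg: "0 \<le> gauss_product s y" for s y :: "'n \<Rightarrow> real"
    unfolding gauss_product_def by (intro prod_nonneg) auto
  have "density Leb (\<lambda>x. ennreal (?p x)) = density Leb (\<lambda>x. ennreal (?p' x))"
    using law by (simp only: S.law_density S'.law_density)
  then have "AE x in Leb. ennreal (?p x) = ennreal (?p' x)"
    by (subst (asm) L.density_unique_iff) measurable
  then have ae: "AE x in Leb. ?p x = ?p' x"
    by (simp add: nonneg)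
  have "continuous_on UNIV ?p" "continuous_on UNIV ?p'"
    unfolding gauss_product_def normal_density_def
    using S.sd_pos S'.sd_pos
    by (auto intro!: continuous_intros S.continuous_on_residual S'.continuous_on_residual simp: less_imp_neq[symmetric])
  then have eq: "?p x = ?p' x" for x
    using continuous_AE_eq[OF _ _ ae] by (metis (no_types, lifting))
  define K K' where "K = (\<Prod>j\<in>UNIV. 1 / sqrt (2 * pi * (\<sigma> j)\<^sup>2))" and "K' = (\<Prod>j\<in>UNIV. 1 / sqrt (2 * pi * (\<sigma>' j)\<^sup>2))"
  have K: "0 < K" "0 < K'"
    unfolding K_def K'_def
    by (intro prod_pos; use less_imp_neq[OF S.sd_pos] less_imp_neq[OF S'.sd_pos] in simp)+
  show ?thesis
  proof
    fix x
    define q q' where "q = (\<Sum>j\<in>UNIV. (S.res x j)\<^sup>2 / (\<sigma> j)\<^sup>2)" and "q' = (\<Sum>j\<in>UNIV. (S'.res x j)\<^sup>2 / (\<sigma>' j)\<^sup>2)"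
    have "K * exp (- q / 2) = K' * exp (- q' / 2)"
      using eq[of x] unfolding gauss_product_exp[OF S.sd_pos] gauss_product_exp[OF S'.sd_pos] K_def K'_def q_def q'_def .
    then have "ln (K * exp (- q / 2)) = ln (K' * exp (- q' / 2))" by simp
    then have "ln K - q / 2 = ln K' - q' / 2" using K by (simp add: ln_mult)
    then show "q = q' + (2 * ln K - 2 * ln K')" by simp
  qed
qed

subsection \<open>Vector derivatives\<close>

lemma has_vector_derivative_vec:
  fixes F :: "real \<Rightarrow> 'n::finite \<Rightarrow> real"
  assumes "\<And>m. ((\<lambda>t. F t m) has_real_derivative F' m) (at t)"
  shows "((\<lambda>t. \<chi> m. F t m) has_vector_derivative (\<chi> m. F' m)) (at t)"
proof -
  have e: "(\<chi> m. h m) = (\<Sum>m\<in>UNIV. h m *\<^sub>R axis m 1)" for h :: "'n \<Rightarrow> real"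
    using basis_expansion[of "\<chi> m. h m"] by (simp add: scalar_mult_eq_scaleR)
  have "((\<lambda>t. F t m *\<^sub>R (axis m 1 :: real ^ 'n)) has_vector_derivative F' m *\<^sub>R axis m 1) (at t)" for m
    using has_vector_derivative_scaleR[OF assms[of m] has_vector_derivative_const[of "axis m 1 :: real ^ 'n"]] by simp
  then show ?thesis unfolding e by (intro has_vector_derivative_sum) simp
qed

lemma has_real_derivative_inner:
  fixes u v :: "real \<Rightarrow> 'a::real_inner"
  assumes "(u has_vector_derivative u') (at t)" "(v has_vector_derivative v') (at t)"
  shows "((\<lambda>t. u t \<bullet> v t) has_real_derivative (u t \<bullet> v' + u' \<bullet> v t)) (at t)"
  using bounded_bilinear.has_vector_derivative[OF bounded_bilinear_inner assms]
  by (simp add: has_real_derivative_iff_has_vector_derivative)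

lemma linear_has_vector_derivative:
  fixes L :: "'a::euclidean_space \<Rightarrow> 'b::real_normed_vector"
  assumes "linear L" "(u has_vector_derivative u') (at t)"
  shows "((\<lambda>t. L (u t)) has_vector_derivative L u') (at t)"
  using bounded_linear.has_vector_derivative[OF linear_conv_bounded_linear[THEN iffD1, OF assms(1)] assms(2)] .

subsection \<open>The curves whose sum is the normalised residual\<close>

context additive_sem
begin

text \<open>The part of the normalised residual vector that depends on the coordinate
  \<open>l\<close>. Such a splitting exists because the equations are additive. Its derivative
  \<open>curve1\<close> has the entry \<open>1 / \<sigma> l\<close> at \<open>l\<close> and is
  otherwise supported on the children of \<open>l\<close>; \<open>curve2\<close>, the second
  derivative, is supported on the children alone.\<close>

definition curve0 :: "'n \<Rightarrow> real \<Rightarrow> real ^ 'n" where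
  "curve0 l t = (\<chi> m. (if m = l then t else if l \<in> pa E m then - f m l t else 0) / \<sigma> m)"

definition curve1 :: "'n \<Rightarrow> real \<Rightarrow> real ^ 'n" where
  "curve1 l t = (\<chi> m. (if m = l then 1 else if l \<in> pa E m then - deriv (f m l) t else 0) / \<sigma> m)"

definition curve2 :: "'n \<Rightarrow> real \<Rightarrow> real ^ 'n" where
  "curve2 l t = (\<chi> m. (if m = l then 0 else if l \<in> pa E m then - deriv (deriv (f m l)) t else 0) / \<sigma> m)"

definition nres :: "('n \<Rightarrow> real) \<Rightarrow> real ^ 'n" where
  "nres x = (\<chi> m. - \<mu> m / \<sigma> m) + (\<Sum>l\<in>UNIV. curve0 l (x l))"

lemma not_self_parent: "l \<notin> pa E l"
  using acyclic_irrefl[OF acyclic] by (simp add: pa_def)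

lemma nres_nth: "nres x $ m = res x m / \<sigma> m"
proof -
  have "(\<Sum>l\<in>UNIV. (if m = l then x l else if l \<in> pa E m then - f m l (x l) else 0) / \<sigma> m) =
    (\<Sum>l\<in>UNIV. (if m = l then x l else 0) / \<sigma> m - (if l \<in> pa E m then f m l (x l) else 0) / \<sigma> m)"
    by (rule sum.cong) (use not_self_parent in auto)
  also have "\<dots> = (x m - (\<Sum>l\<in>pa E m. f m l (x l))) / \<sigma> m"
    by (simp add: sum_subtractf sum_divide_distrib[symmetric] sum.If_cases diff_divide_distrib)
  finally show ?thesis
    by (simp add: nres_def curve0_def residual_def diff_divide_distrib)
qed

lemma nres_inner: "nres x \<bullet> nres x = (\<Sum>m\<in>UNIV. (res x m)\<^sup>2 / (\<sigma> m)\<^sup>2)"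
  by (simp add: inner_vec_def nres_nth power2_eq_square)

lemma curve0_deriv: "(curve0 l has_vector_derivative curve1 l t) (at t)"
  unfolding curve0_def curve1_def
  by (rule has_vector_derivative_vec)
    (use less_imp_neq[OF sd_pos, symmetric] in \<open>auto intro!: derivative_eq_intros C2_DERIV C2_f\<close>)

lemma curve1_deriv: "(curve1 l has_vector_derivative curve2 l t) (at t)"
  unfolding curve1_def curve2_def
  by (rule has_vector_derivative_vec)
    (use less_imp_neq[OF sd_pos, symmetric] in \<open>auto intro!: derivative_eq_intros C2_DERIV2 C2_f\<close>)

lemma nres_upd: "nres (x(l := t)) = nres x + (curve0 l t - curve0 l (x l))"
proof -
  have "(\<Sum>m\<in>UNIV. curve0 m ((x(l := t)) m)) = curve0 l t + (\<Sum>m\<in>UNIV - {l}. curve0 m (x m))"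
    by (subst sum.remove[of _ l]) (auto intro!: sum.cong)
  moreover have "(\<Sum>m\<in>UNIV. curve0 m (x m)) = curve0 l (x l) + (\<Sum>m\<in>UNIV - {l}. curve0 m (x m))"
    by (subst sum.remove[of _ l]) auto
  ultimately show ?thesis by (simp add: nres_def)
qed

lemma nres_deriv: "((\<lambda>t. nres (x(l := t))) has_vector_derivative curve1 l t) (at t)"
proof -
  have "((\<lambda>t. nres x + (curve0 l t - curve0 l (x l))) has_vector_derivative 0 + (curve1 l t - 0)) (at t)"
    by (intro has_vector_derivative_add has_vector_derivative_diff has_vector_derivative_const curve0_deriv)
  then show ?thesis by (simp add: nres_upd)
qed

lemma residual_upd_self: "res (x(k := t)) k = res x k + (t - x k)"
proof -
  have "(\<Sum>i\<in>pa E k. f k i ((x(k := t)) i)) = (\<Sum>i\<in>pa E k. f k i (x i))"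
    by (rule sum.cong) (use not_self_parent in auto)
  then show ?thesis by (simp add: residual_def)
qed

lemma residual_upd_other:
  assumes "m \<noteq> k" "k \<notin> pa E m"
  shows "res (x(k := t)) m = res x m"
proof -
  have "(\<Sum>i\<in>pa E m. f m i ((x(k := t)) i)) = (\<Sum>i\<in>pa E m. f m i (x i))"
    by (rule sum.cong) (use assms in auto)
  then show ?thesis using assms(1) by (simp add: residual_def)
qed

lemma inner_curve1: "w \<bullet> curve1 m s = w $ m / \<sigma> m - (\<Sum>c\<in>{c. m \<in> pa E c}. w $ c * deriv (f c m) s / \<sigma> c)"
proof -
  have "w \<bullet> curve1 m s = (\<Sum>c\<in>UNIV. (if c = m then w $ c / \<sigma> c else 0) - (if m \<in> pa E c then w $ c * deriv (f c m) s / \<sigma> c else 0))"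
    unfolding inner_vec_def curve1_def by (rule sum.cong) (use not_self_parent in auto)
  then show ?thesis by (simp add: sum_subtractf sum.If_cases)
qed

text \<open>Each tangent has a nonzero entry at its own vertex and further entries only at children.
  Orthogonality to the tangents of all strict descendants of \<open>k\<close> is thus a triangular
  system, solved from the sinks upwards.\<close>

lemma orthogonal_descendant_zero:
  assumes orth: "\<And>l. l \<noteq> k \<Longrightarrow> w \<bullet> curve1 l (x l) = 0" and m: "(k, m) \<in> E\<^sup>+"
  shows "w $ m = 0"
proof -
  have "acyclic (E\<inverse>)" using acyclic by simp
  then have "(k, m) \<in> E\<^sup>+ \<longrightarrow> w $ m = 0"
  proof (induction m rule: acyclic_induct)
    case (step m)
    show ?case
    proof
      assume km: "(k, m) \<in> E\<^sup>+"
      have "(\<Sum>c\<in>{c. m \<in> pa E c}. w $ c * deriv (f c m) (x m) / \<sigma> c) = 0"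
      proof (rule sum.neutral, rule ballI)
        fix c assume "c \<in> {c. m \<in> pa E c}"
        then have mc: "(m, c) \<in> E" by (simp add: pa_def)
        then have "(k, c) \<in> E\<^sup>+" using km by (rule trancl.trancl_into_trancl[rotated])
        then have "w $ c = 0" using step[of c] mc by simp
        then show "w $ c * deriv (f c m) (x m) / \<sigma> c = 0" by simp
      qed
      moreover have "m \<noteq> k" using km acyclic by (auto simp: acyclic_def)
      ultimately show "w $ m = 0"
        using orth[of m] inner_curve1[of w m "x m"] sd_pos[of m] by simp
    qed
  qed
  then show ?thesis using m by blast
qed

lemma inner_curve2_zero:
  assumes "\<And>m. (k, m) \<in> E \<Longrightarrow> w $ m = 0"
  shows "w \<bullet> curve2 k t = 0"
  unfolding inner_vec_def curve2_def by (rule sum.neutral) (use assms in \<open>auto simp: pa_def\<close>)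

end

subsection \<open>Eliminating the sinks of a second model\<close>

locale sem_pair = S: additive_sem E \<mu> f \<sigma> X + S': additive_sem E' \<mu>' f' \<sigma>' X'
  for E :: "('n::finite \<times> 'n) set" and \<mu> f \<sigma> X and E' :: "('n \<times> 'n) set" and \<mu>' f' \<sigma>' X' +
  assumes same_law: "distr (noise_space \<sigma>) Rp X = distr (noise_space \<sigma>') Rp X'"
begin

text \<open>\<open>L\<close> is the orthogonal projection along the span of the curves of the vertices in \<open>K\<close>; the
  last clause says that minimising the quadratic form of \<open>E\<close> over the coordinates in \<open>K\<close> leaves the
  quadratic form of \<open>E'\<close> without the squares of the vertices in \<open>K\<close>.\<close>

definition eliminates :: "'n set \<Rightarrow> (real ^ 'n \<Rightarrow> real ^ 'n) \<Rightarrow> bool" where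
  "eliminates K L \<longleftrightarrow> linear L \<and> (\<forall>y z. L y \<bullet> z = L y \<bullet> L z) \<and>
     (\<forall>m\<in>K. \<forall>t. L (S.curve1 m t) = 0) \<and>
     (\<forall>y. \<exists>a. y - L y = (\<Sum>m\<in>K. a m *\<^sub>R S.curve1 m 0)) \<and>
     (\<exists>c. \<forall>x. L (S.nres x) \<bullet> L (S.nres x) = (\<Sum>m\<in>-K. (S'.res x m)\<^sup>2 / (\<sigma>' m)\<^sup>2) + c)"

lemma eliminatesD:
  assumes "eliminates K L"
  shows "linear L" "L y \<bullet> z = L y \<bullet> L z" "m \<in> K \<Longrightarrow> L (S.curve1 m t) = 0"
    "\<exists>a. y - L y = (\<Sum>m\<in>K. a m *\<^sub>R S.curve1 m 0)"
    "\<exists>c. \<forall>x. L (S.nres x) \<bullet> L (S.nres x) = (\<Sum>m\<in>-K. (S'.res x m)\<^sup>2 / (\<sigma>' m)\<^sup>2) + c"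
  using assms unfolding eliminates_def by blast+

context
  fixes K L k
  assumes el: "eliminates K L" and k: "k \<notin> K" and sink: "\<And>m. (k, m) \<in> E' \<Longrightarrow> m \<in> K"
begin

lemma linear_L: "linear L" by (rule eliminatesD(1)[OF el])

lemma L_nres_deriv: "((\<lambda>t. L (S.nres (x(l := t)))) has_vector_derivative L (S.curve1 l t)) (at t)"
  by (rule linear_has_vector_derivative[OF linear_L S.nres_deriv])

lemma L_curve1_deriv: "((\<lambda>t. L (S.curve1 l t)) has_vector_derivative L (S.curve2 l t)) (at t)"
  by (rule linear_has_vector_derivative[OF linear_L S.curve1_deriv])

text \<open>Outside \<open>K\<close> the coordinate of \<open>k\<close> occurs only in the residual
  of \<open>k\<close> itself, with derivative 1, because all children of \<open>k\<close> in
  \<open>E'\<close> lie in \<open>K\<close>. The identity is half the derivative in that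
  coordinate.\<close>

lemma first_derivative: "L (S.nres x) \<bullet> L (S.curve1 k (x k)) = S'.res x k / (\<sigma>' k)\<^sup>2"
proof -
  obtain c where c: "\<And>x. L (S.nres x) \<bullet> L (S.nres x) = (\<Sum>m\<in>-K. (S'.res x m)\<^sup>2 / (\<sigma>' m)\<^sup>2) + c"
    using eliminatesD(5)[OF el] by blast
  have s: "\<sigma>' k \<noteq> 0" using S'.sd_pos[of k] by simp
  let ?c = "(\<Sum>m\<in>-K - {k}. (S'.res x m)\<^sup>2 / (\<sigma>' m)\<^sup>2) + c"
  have "L (S.nres (x(k := t))) \<bullet> L (S.nres (x(k := t))) = (S'.res x k + (t - x k))\<^sup>2 / (\<sigma>' k)\<^sup>2 + ?c" for t
  proof -
    have "(\<Sum>m\<in>-K. (S'.res (x(k := t)) m)\<^sup>2 / (\<sigma>' m)\<^sup>2) =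
      (S'.res (x(k := t)) k)\<^sup>2 / (\<sigma>' k)\<^sup>2 + (\<Sum>m\<in>-K - {k}. (S'.res (x(k := t)) m)\<^sup>2 / (\<sigma>' m)\<^sup>2)"
      using k by (intro sum.remove) auto
    also have "(\<Sum>m\<in>-K - {k}. (S'.res (x(k := t)) m)\<^sup>2 / (\<sigma>' m)\<^sup>2) = (\<Sum>m\<in>-K - {k}. (S'.res x m)\<^sup>2 / (\<sigma>' m)\<^sup>2)"
    proof (rule sum.cong[OF refl])
      fix m assume "m \<in> -K - {k}"
      then have "S'.res (x(k := t)) m = S'.res x m"
        using sink[of m] by (intro S'.residual_upd_other) (auto simp: pa_def)
      then show "(S'.res (x(k := t)) m)\<^sup>2 / (\<sigma>' m)\<^sup>2 = (S'.res x m)\<^sup>2 / (\<sigma>' m)\<^sup>2" by (simp only:)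
    qed
    finally show ?thesis by (simp only: c S'.residual_upd_self add.assoc)
  qed
  moreover have "((\<lambda>t. (S'.res x k + (t - x k))\<^sup>2 / (\<sigma>' k)\<^sup>2 + ?c) has_real_derivative 2 * S'.res x k / (\<sigma>' k)\<^sup>2) (at (x k))"
    using s by (auto intro!: derivative_eq_intros simp: field_simps power2_eq_square)
  ultimately have "((\<lambda>t. L (S.nres (x(k := t))) \<bullet> L (S.nres (x(k := t)))) has_real_derivative 2 * S'.res x k / (\<sigma>' k)\<^sup>2) (at (x k))"
    by (simp only:)
  moreover note has_real_derivative_inner[OF L_nres_deriv[of x k "x k"] L_nres_deriv[of x k "x k"]]
  ultimately have "L (S.nres (x(k := x k))) \<bullet> L (S.curve1 k (x k)) + L (S.curve1 k (x k)) \<bullet> L (S.nres (x(k := x k))) =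
     2 * S'.res x k / (\<sigma>' k)\<^sup>2"
    using DERIV_unique by blast
  then show ?thesis by (simp add: inner_commute)
qed

text \<open>Differentiating once more leaves a constant on the side of \<open>E'\<close>; this
  rigidity is all that the second model contributes to the straightness of the curve.\<close>

lemma second_derivative:
  "L (S.curve1 k (x k)) \<bullet> L (S.curve1 k (x k)) + L (S.nres x) \<bullet> L (S.curve2 k (x k)) = 1 / (\<sigma>' k)\<^sup>2"
proof -
  have "L (S.nres (x(k := t))) \<bullet> L (S.curve1 k t) = (S'.res x k + (t - x k)) / (\<sigma>' k)\<^sup>2" for t
    using first_derivative[of "x(k := t)"] by (simp add: S'.residual_upd_self)
  moreover have "((\<lambda>t. (S'.res x k + (t - x k)) / (\<sigma>' k)\<^sup>2) has_real_derivative 1 / (\<sigma>' k)\<^sup>2) (at (x k))"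
    by (rule DERIV_cdivide) (auto intro!: derivative_eq_intros)
  ultimately have "((\<lambda>t. L (S.nres (x(k := t))) \<bullet> L (S.curve1 k t)) has_real_derivative 1 / (\<sigma>' k)\<^sup>2) (at (x k))"
    by (simp only:)
  moreover note has_real_derivative_inner[OF L_nres_deriv[of x k "x k"] L_curve1_deriv[of k "x k"]]
  ultimately have "L (S.nres (x(k := x k))) \<bullet> L (S.curve2 k (x k)) + L (S.curve1 k (x k)) \<bullet> L (S.curve1 k (x k)) = 1 / (\<sigma>' k)\<^sup>2"
    using DERIV_unique by blast
  then show ?thesis by (simp add: add.commute)
qed

lemma mixed_derivative:
  assumes "l \<noteq> k"
  shows "L (S.curve1 l t) \<bullet> L (S.curve2 k s) = 0"
proof -
  \<comment> \<open>Coordinate \<open>k\<close> stays at \<open>s\<close> while coordinate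
    \<open>l\<close> moves. In \<open>second_derivative\<close> only the residual vector then
    depends on \<open>t\<close>, so its derivative paired with the second derivative of the curve of
    \<open>k\<close> is zero.\<close>
  let ?x = "\<lambda>t. (\<lambda>_. s)(l := t)"
  have "L (S.nres (?x t)) \<bullet> L (S.curve2 k s) = 1 / (\<sigma>' k)\<^sup>2 - L (S.curve1 k s) \<bullet> L (S.curve1 k s)" for t
    using second_derivative[of "?x t"] assms by simp
  then have "((\<lambda>t. L (S.nres (?x t)) \<bullet> L (S.curve2 k s)) has_real_derivative 0) (at t)"
    by (simp only: DERIV_const)
  moreover note has_real_derivative_inner[OF L_nres_deriv[of "\<lambda>_. s" l t] has_vector_derivative_const[of "L (S.curve2 k s)"]]
  ultimately have "L (S.nres (?x t)) \<bullet> 0 + L (S.curve1 l t) \<bullet> L (S.curve2 k s) = 0"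
    using DERIV_unique by blast
  then show ?thesis by simp
qed

text \<open>The projected second derivative \<open>w\<close> is orthogonal to the tangents of all
  other vertices, hence zero at the strict descendants of \<open>k\<close> in \<open>E\<close>. But
  \<open>curve2 k\<close> lives on the children of \<open>k\<close>, so it is orthogonal to
  \<open>w\<close>; since \<open>w\<close> is its projection, \<open>w\<close> has norm
  zero.\<close>

lemma L_curve2_zero: "L (S.curve2 k s) = 0"
proof -
  define w where "w = L (S.curve2 k s)"
  have orth: "w \<bullet> S.curve1 l t = 0" if "l \<noteq> k" for l t
    using mixed_derivative[OF that, of t s] eliminatesD(2)[OF el, of "S.curve2 k s" "S.curve1 l t"]
    by (simp add: w_def inner_commute)
  have "w $ m = 0" if "(k, m) \<in> E" for m
    by (rule S.orthogonal_descendant_zero[of k w "\<lambda>_. 0"]) (use orth that in auto)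
  then have "w \<bullet> S.curve2 k s = 0" by (rule S.inner_curve2_zero)
  then have "w \<bullet> w = 0"
    using eliminatesD(2)[OF el, of "S.curve2 k s" "S.curve2 k s"] by (simp add: w_def)
  then show ?thesis by (simp add: w_def)
qed

lemma L_curve1_const: "L (S.curve1 k t) = L (S.curve1 k 0)"
proof -
  have "((\<lambda>t. L (S.curve1 k t)) has_derivative (\<lambda>h. 0)) (at t within UNIV)" for t
    using L_curve1_deriv[of k t] L_curve2_zero[of t] by (simp add: has_vector_derivative_def)
  then obtain c where "\<And>t. L (S.curve1 k t) = c"
    using has_derivative_zero_constant[of UNIV "\<lambda>t. L (S.curve1 k t)"] by auto
  then show ?thesis by simp
qed

text \<open>The projected tangent of \<open>k\<close> is a constant vector \<open>v\<close> with
  squared norm \<open>1 / s\<close>. Removing the component along \<open>v\<close> lowers the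
  quadratic form by exactly the normalised square of the residual of \<open>k\<close> in
  \<open>E'\<close>, by \<open>first_derivative\<close>.\<close>

lemma eliminates_insert: "\<exists>L'. eliminates (insert k K) L'"
proof -
  define s where "s = (\<sigma>' k)\<^sup>2"
  have s: "0 < s" using S'.sd_pos[of k] by (simp add: s_def)
  define v where "v = L (S.curve1 k 0)"
  have vv: "v \<bullet> v = 1 / s"
    using second_derivative[of "\<lambda>_. 0"] by (simp add: v_def s_def L_curve2_zero)
  have Lv: "L y \<bullet> v = y \<bullet> v" for y
    using eliminatesD(2)[OF el, of "S.curve1 k 0" y] by (simp add: v_def inner_commute)
  \<comment> \<open>The factor \<open>s\<close> is the reciprocal of \<open>v \<bullet> v\<close>.
    Pairing with \<open>y\<close> instead of \<open>L y\<close> makes no difference, since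
    \<open>v\<close> lies in the range of \<open>L\<close>.\<close>
  define L' where "L' y = L y - (s * (y \<bullet> v)) *\<^sub>R v" for y
  have lin: "linear L'"
  proof (rule linearI)
    show "L' (y + z) = L' y + L' z" for y z
      by (simp add: L'_def linear_add[OF linear_L] inner_add_left algebra_simps)
    show "L' (r *\<^sub>R y) = r *\<^sub>R L' y" for r y
      by (simp add: L'_def linear_cmul[OF linear_L] algebra_simps)
  qed
  have LL: "L' y \<bullet> L' z = L y \<bullet> L z - s * (y \<bullet> v) * (z \<bullet> v)" for y z
  proof -
    have "L' y \<bullet> L' z = L y \<bullet> L z - s * (z \<bullet> v) * (L y \<bullet> v) - s * (y \<bullet> v) * (L z \<bullet> v)
        + s * (y \<bullet> v) * (z \<bullet> v) * (s * (v \<bullet> v))"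
      by (simp add: L'_def inner_diff_left inner_diff_right inner_commute algebra_simps)
    then show ?thesis using s by (simp add: Lv vv)
  qed
  have proj: "L' y \<bullet> z = L' y \<bullet> L' z" for y z
    unfolding LL using eliminatesD(2)[OF el, of y z]
    by (simp add: L'_def inner_diff_left inner_commute[of v z])
  have vanish: "L' (S.curve1 m t) = 0" if "m \<in> insert k K" for m t
  proof (cases "m = k")
    case True
    have "S.curve1 k t \<bullet> v = v \<bullet> v" using Lv[of "S.curve1 k t"] by (simp add: L_curve1_const[of t] v_def)
    then show ?thesis using True s by (simp add: L'_def L_curve1_const[of t] vv flip: v_def)
  next
    case False
    then have "L (S.curve1 m t) = 0" using that eliminatesD(3)[OF el] by blast
    then show ?thesis using Lv[of "S.curve1 m t"] by (simp add: L'_def)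
  qed
  have span: "\<exists>a. y - L' y = (\<Sum>m\<in>insert k K. a m *\<^sub>R S.curve1 m 0)" for y
  proof -
    obtain a where a: "y - L y = (\<Sum>m\<in>K. a m *\<^sub>R S.curve1 m 0)" using eliminatesD(4)[OF el] by blast
    \<comment> \<open>\<open>v\<close> differs from the tangent of \<open>k\<close> by a combination
      of the tangents of \<open>K\<close>, so what \<open>L'\<close> removes stays in the span of
      the tangents.\<close>
    obtain b where b: "S.curve1 k 0 - v = (\<Sum>m\<in>K. b m *\<^sub>R S.curve1 m 0)"
      unfolding v_def using eliminatesD(4)[OF el] by blast
    define r where "r = s * (y \<bullet> v)"
    have "y - L' y = (y - L y) + r *\<^sub>R S.curve1 k 0 - r *\<^sub>R (S.curve1 k 0 - v)"
      by (simp add: L'_def r_def algebra_simps)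
    also have "\<dots> = r *\<^sub>R S.curve1 k 0 + (\<Sum>m\<in>K. (a m - r * b m) *\<^sub>R S.curve1 m 0)"
      unfolding a b by (simp add: scaleR_sum_right scaleR_diff_left sum_subtractf)
    also have "\<dots> = (\<Sum>m\<in>insert k K. (if m = k then r else a m - r * b m) *\<^sub>R S.curve1 m 0)"
    proof -
      have "(\<Sum>m\<in>K. (if m = k then r else a m - r * b m) *\<^sub>R S.curve1 m 0) = (\<Sum>m\<in>K. (a m - r * b m) *\<^sub>R S.curve1 m 0)"
        by (rule sum.cong) (use k in auto)
      then show ?thesis using k by simp
    qed
    finally show ?thesis by (intro exI[of _ "\<lambda>m. if m = k then r else a m - r * b m"])
  qed
  obtain c where c: "\<And>x. L (S.nres x) \<bullet> L (S.nres x) = (\<Sum>m\<in>-K. (S'.res x m)\<^sup>2 / (\<sigma>' m)\<^sup>2) + c"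
    using eliminatesD(5)[OF el] by blast
  have "L' (S.nres x) \<bullet> L' (S.nres x) = (\<Sum>m\<in>-insert k K. (S'.res x m)\<^sup>2 / (\<sigma>' m)\<^sup>2) + c" for x
  proof -
    have "S.nres x \<bullet> v = S'.res x k / s"
      using first_derivative[of x] Lv[of "S.nres x"] by (simp add: L_curve1_const[of "x k"] s_def flip: v_def)
    then have "L' (S.nres x) \<bullet> L' (S.nres x) = (\<Sum>m\<in>-K. (S'.res x m)\<^sup>2 / (\<sigma>' m)\<^sup>2) + c - (S'.res x k)\<^sup>2 / s"
      unfolding LL c using s by (simp add: power2_eq_square)
    also have "(\<Sum>m\<in>-K. (S'.res x m)\<^sup>2 / (\<sigma>' m)\<^sup>2) =
        (S'.res x k)\<^sup>2 / s + (\<Sum>m\<in>-K - {k}. (S'.res x m)\<^sup>2 / (\<sigma>' m)\<^sup>2)"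
      unfolding s_def using k by (intro sum.remove) auto
    also have "-K - {k} = -insert k K" by auto
    finally show ?thesis by simp
  qed
  then have "eliminates (insert k K) L'"
    unfolding eliminates_def using lin proj vanish span by blast
  then show ?thesis by blast
qed

end

lemma eliminates_exists:
  assumes "upclosed E' K"
  shows "\<exists>L. eliminates K L"
  using S'.acyclic assms
proof (induction K rule: upclosed_induct)
  case empty
  obtain c where c: "\<And>x. (\<Sum>j\<in>UNIV. (S.res x j)\<^sup>2 / (\<sigma> j)\<^sup>2) = (\<Sum>j\<in>UNIV. (S'.res x j)\<^sup>2 / (\<sigma>' j)\<^sup>2) + c"
    using same_law_quadratic[OF S.additive_sem_axioms S'.additive_sem_axioms same_law] by blast
  have "eliminates {} (\<lambda>y. y)"
    unfolding eliminates_def using c by (simp add: S.nres_inner linear_id[unfolded id_def])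
  then show ?case by blast
next
  case (insert K k)
  then show ?case using eliminates_insert by blast
qed

text \<open>With \<open>K\<close> the strict descendants of \<open>i\<close> in \<open>E'\<close>, \<open>curve2 i\<close> is a combination of the tangents of \<open>K\<close>.
  The coefficients at the ancestors of \<open>i\<close> in \<open>E\<close> vanish, and the other parents of \<open>j\<close> are such
  ancestors, so that the \<open>j\<close>-th entry of \<open>curve2 i\<close> is zero.\<close>

lemma covered_reversed_deriv2_zero:
  assumes cov: "covered E i j" and rev: "(j, i) \<in> E'"
  shows "deriv (deriv (f j i)) t = 0"
proof -
  define K where "K = {m. (i, m) \<in> E'\<^sup>+}"
  have "upclosed E' K" by (auto simp: upclosed_def K_def intro: trancl_into_trancl)
  then obtain L where L: "eliminates K L" using eliminates_exists by blast
  have iK: "i \<notin> K" using S'.acyclic by (auto simp: K_def acyclic_def)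
  have jK: "j \<notin> K" using rev S'.acyclic by (auto simp: K_def acyclic_def dest: trancl_into_trancl)
  have ij: "i \<in> pa E j" "pa E j = insert i (pa E i)" using cov by (auto simp: covered_def pa_def)
  have ne: "i \<noteq> j" using ij(1) S.not_self_parent by auto
  have "L (S.curve2 i t) = 0"
    by (rule L_curve2_zero[OF L iK]) (simp add: K_def)
  then obtain a where a: "S.curve2 i t = (\<Sum>m\<in>K. a m *\<^sub>R S.curve1 m 0)"
    using eliminatesD(4)[OF L, of "S.curve2 i t"] by auto
  \<comment> \<open>Entry \<open>m\<close> of a tangent \<open>curve1 l 0\<close> can be nonzero
    only if \<open>l\<close> is \<open>m\<close> or a parent of \<open>m\<close>. If the
    coefficients of the parents vanish, only the term of \<open>m\<close> itself remains.\<close>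
  have comp: "S.curve2 i t $ m = (if m \<in> K then a m / \<sigma> m else 0)"
    if "\<And>l. l \<in> K \<Longrightarrow> l \<in> pa E m \<Longrightarrow> a l = 0" for m
  proof -
    have "S.curve2 i t $ m = (\<Sum>l\<in>K. a l * S.curve1 l 0 $ m)" by (simp add: a)
    also have "\<dots> = (\<Sum>l\<in>K. if m = l then a m / \<sigma> m else 0)"
      by (rule sum.cong) (use that in \<open>auto simp: S.curve1_def\<close>)
    finally show ?thesis by (simp add: sum.If_cases)
  qed
  \<comment> \<open>A strict ancestor m of \<open>i\<close> is neither \<open>i\<close> nor one of
    its children, so \<open>curve2 i\<close> is zero at m. Going down from the sources, the
    coefficients of the parents of m are already known to vanish.\<close>
  have anc: "(m, i) \<in> E\<^sup>+ \<longrightarrow> m \<in> K \<longrightarrow> a m = 0" for m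
    using S.acyclic
  proof (induction m rule: acyclic_induct)
    case (step m)
    show ?case
    proof (intro impI)
      assume mi: "(m, i) \<in> E\<^sup>+" and mK: "m \<in> K"
      have "a l = 0" if "l \<in> K" "l \<in> pa E m" for l
        using step[of l] that mi by (auto simp: pa_def intro: trancl_into_trancl2)
      then have "S.curve2 i t $ m = a m / \<sigma> m" using comp[of m] mK by simp
      moreover have "i \<notin> pa E m" "m \<noteq> i"
        using mi S.acyclic by (auto simp: pa_def acyclic_def dest: trancl_into_trancl2)
      ultimately show "a m = 0" using S.sd_pos[of m] by (simp add: S.curve2_def)
    qed
  qed
  \<comment> \<open>Since \<open>i\<close> is not in \<open>K\<close>, a parent of \<open>j\<close>
    in \<open>K\<close> is a parent of \<open>i\<close>, that is, an ancestor. The term of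
    \<open>j\<close> itself is absent as well, because j -> i in \<open>E'\<close> keeps
    \<open>j\<close> out of \<open>K\<close>.\<close>
  have "a l = 0" if "l \<in> K" "l \<in> pa E j" for l
    using anc[of l] that iK unfolding ij(2) by (auto simp: pa_def)
  then have "S.curve2 i t $ j = 0"
    using comp[of j] jK by simp
  then show ?thesis using ij(1) ne S.sd_pos[of j] by (simp add: S.curve2_def)
qed

end

subsection \<open>Reversing a covered linear edge\<close>

text \<open>Substituting the equation of \<open>i\<close> into that of \<open>j\<close> removes the
  coordinate of \<open>i\<close> and leaves the functions \<open>h\<close> and the noise \<eta>. In
  the equation of \<open>i\<close> the noise is c \<eta> + \<zeta>, and \<eta> is expressed through
  the new equation of \<open>j\<close>. The new functions may cancel to zero, so the result is only
  an \<open>additive_sem\<close>.\<close>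

lemma (in additive_sem) reverse_covered_linear:
  assumes cov: "covered E i j" and lin: "f j i = (\<lambda>x. b * x + d)"
  obtains f' \<sigma>' X' where "additive_sem (flip E i j) \<mu> f' \<sigma>' X'" "distr (noise_space \<sigma>') Rp X' = law"
proof -
  have ij: "(i, j) \<in> E" "pa E j = insert i (pa E i)" using cov by (auto simp: covered_def)
  have iZ: "i \<notin> pa E i" by (rule not_self_parent)
  have ne: "i \<noteq> j" using ij(1) acyclic_irrefl[OF acyclic] by auto
  have jZ: "j \<notin> pa E i" using not_self_parent[of j] ij(2) by auto
  note paF = pa_flip[OF acyclic cov]
  define c where "c = b * (\<sigma> i)\<^sup>2 / (b\<^sup>2 * (\<sigma> i)\<^sup>2 + (\<sigma> j)\<^sup>2)"
  define \<sigma>' where "\<sigma>' = mixed_sd i j b \<sigma>"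
  define T where "T = unmix i j b c"
  have T: "T \<in> measurable (noise_space \<sigma>') N" and dT: "distr (noise_space \<sigma>') N T = N"
    unfolding T_def \<sigma>'_def using measurable_unmix[OF sd_pos ne c_def] distr_unmix[OF sd_pos ne c_def] by auto
  define X' where "X' w = X (T w)" for w
  define h where "h l = (\<lambda>x. 1 * f j l x + b * f i l x)" for l
  \<comment> \<open>The constant \<open>- c * \<mu> j\<close> centres the reversed linear function;
    \<open>- c * h l\<close> compensates for expressing \<eta> through the coordinate of
    \<open>j\<close>.\<close>
  define f' where "f' k l = (if k = j then h l
      else if k = i then (if l = j then (\<lambda>x. c * x + (- c * \<mu> j)) else (\<lambda>x. 1 * f i l x + (- c) * h l x))
      else f k l)" for k l
  have transfer: "integrable (noise_space \<sigma>') (\<lambda>w. \<phi> (T w))" "(\<integral>w. \<phi> (T w) \<partial>noise_space \<sigma>') = (\<integral>\<omega>. \<phi> \<omega> \<partial>N)"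
    if "integrable N \<phi>" for \<phi> :: "('n \<Rightarrow> real) \<Rightarrow> real"
  proof -
    have m: "\<phi> \<in> borel_measurable N" using that by (rule borel_measurable_integrable)
    have "integrable (distr (noise_space \<sigma>') N T) \<phi>" using that by (simp only: dT)
    then show "integrable (noise_space \<sigma>') (\<lambda>w. \<phi> (T w))" using integrable_distr_eq[OF T m] by blast
    show "(\<integral>w. \<phi> (T w) \<partial>noise_space \<sigma>') = (\<integral>\<omega>. \<phi> \<omega> \<partial>N)"
      using integral_distr[OF T m] by (simp only: dT)
  qed
  \<comment> \<open>Centring of the linear edge function; it makes the intercept at \<open>j\<close>
    stay \<open>\<mu> j\<close> after the substitution.\<close>
  have bd: "b * \<mu> i + d = 0"
  proof -
    have "(\<integral>\<omega>. b * X \<omega> i + d \<partial>N) = 0" using mean_f[of i j] ij(2) by (simp add: lin)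
    then show ?thesis using integrable_X[of i] mean_X[of i] N.prob_space by simp
  qed
  have Zj: "l \<in> pa E i \<Longrightarrow> l \<in> pa E j" for l using ij(2) by simp
  have h: "C2 (h l)" "integrable N (\<lambda>\<omega>. h l (X \<omega> l))" "(\<integral>\<omega>. h l (X \<omega> l) \<partial>N) = 0" if "l \<in> pa E i" for l
  proof -
    show "C2 (h l)" unfolding h_def by (rule C2_linear_combination[OF C2_f[OF Zj[OF that]] C2_f[OF that]])
    show "integrable N (\<lambda>\<omega>. h l (X \<omega> l))" "(\<integral>\<omega>. h l (X \<omega> l) \<partial>N) = 0"
      unfolding h_def using integrable_f[OF that] integrable_f[OF Zj[OF that]] mean_f[OF that] mean_f[OF Zj[OF that]]
      by simp_all
  qed
  have f': "C2 (f' k l) \<and> integrable N (\<lambda>\<omega>. f' k l (X \<omega> l)) \<and> (\<integral>\<omega>. f' k l (X \<omega> l) \<partial>N) = 0"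
    if kl: "l \<in> pa (flip E i j) k" for k l
  proof -
    consider "k = j" "l \<in> pa E i" | "k = i" "l = j" | "k = i" "l \<in> pa E i" "l \<noteq> j" | "k \<noteq> i" "k \<noteq> j" "l \<in> pa E k"
      using kl paF jZ by (cases "k = i"; cases "k = j") auto
    then show ?thesis
    proof cases
      case 1
      then show ?thesis using h[of l] by (simp add: f'_def)
    next
      case 2
      then have "f' k l = (\<lambda>x. c * x + (- c * \<mu> j))" using ne by (simp add: f'_def)
      then show ?thesis using integrable_X[of j] mean_X[of j] N.prob_space 2(2) C2_affine[of c "- c * \<mu> j"] by simp
    next
      case 3
      then have e: "f' k l = (\<lambda>x. 1 * f i l x + (- c) * h l x)" using ne by (simp add: f'_def)
      have "C2 (f' k l)" unfolding e by (rule C2_linear_combination[OF C2_f[OF 3(2)] h(1)[OF 3(2)]])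
      then show ?thesis using h(2,3)[OF 3(2)] integrable_f[OF 3(2)] mean_f[OF 3(2)] by (simp add: e)
    next
      case 4
      then show ?thesis using C2_f integrable_f mean_f by (simp add: f'_def)
    qed
  qed
  have Tj: "b * T w i + T w j = w j" and Ti: "T w i = w i + c * w j" and Tk: "k \<noteq> i \<Longrightarrow> k \<noteq> j \<Longrightarrow> T w k = w k" for w k
    using ne by (auto simp: T_def unmix_def)
  have sumj: "(\<Sum>l\<in>pa E j. f j l (x l)) = b * x i + d + (\<Sum>l\<in>pa E i. f j l (x l))" for x
    using iZ by (simp add: ij(2) lin)
  have eqj: "X' w j = \<mu> j + (\<Sum>l\<in>pa E i. h l (X' w l)) + w j" for w
  proof -
    have 1: "X' w i = \<mu> i + (\<Sum>l\<in>pa E i. f i l (X' w l)) + T w i"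
      and 2: "X' w j = \<mu> j + (b * X' w i + d + (\<Sum>l\<in>pa E i. f j l (X' w l))) + T w j"
      unfolding X'_def by (rule X_eq) (rule trans[OF X_eq], simp only: sumj)
    have 3: "(\<Sum>l\<in>pa E i. h l (X' w l)) = (\<Sum>l\<in>pa E i. f j l (X' w l)) + b * (\<Sum>l\<in>pa E i. f i l (X' w l))"
      by (simp add: h_def sum.distrib sum_distrib_left)
    have 4: "b * X' w i = b * \<mu> i + b * (\<Sum>l\<in>pa E i. f i l (X' w l)) + b * T w i"
      using arg_cong[OF 1, of "\<lambda>z. b * z"] by (simp only: distrib_left)
    show ?thesis using 2 3 4 bd Tj[of w] by linarith
  qed
  have eqi: "X' w i = \<mu> i + (c * X' w j + (- c * \<mu> j) + (\<Sum>l\<in>pa E i. 1 * f i l (X' w l) + (- c) * h l (X' w l))) + w i" for w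
  proof -
    have 1: "X' w i = \<mu> i + (\<Sum>l\<in>pa E i. f i l (X' w l)) + T w i"
      unfolding X'_def by (rule X_eq)
    have 2: "(\<Sum>l\<in>pa E i. 1 * f i l (X' w l) + (- c) * h l (X' w l)) = (\<Sum>l\<in>pa E i. f i l (X' w l)) - c * (\<Sum>l\<in>pa E i. h l (X' w l))"
      by (simp add: sum_subtractf sum_distrib_left)
    have 3: "c * X' w j = c * \<mu> j + c * (\<Sum>l\<in>pa E i. h l (X' w l)) + c * w j"
      using arg_cong[OF eqj[of w], of "\<lambda>z. c * z"] by (simp only: distrib_left)
    show ?thesis using 1 2 3 Ti[of w] by linarith
  qed
  have X'_eq: "X' w k = \<mu> k + (\<Sum>l\<in>pa (flip E i j) k. f' k l (X' w l)) + w k" for w k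
  proof -
    consider "k = j" | "k = i" | "k \<noteq> i" "k \<noteq> j" by blast
    then show ?thesis
    proof cases
      case 1
      have "(\<Sum>l\<in>pa (flip E i j) k. f' k l (X' w l)) = (\<Sum>l\<in>pa E i. h l (X' w l))"
        unfolding 1 paF by (simp add: f'_def)
      then show ?thesis using eqj[of w] by (simp only: 1)
    next
      case 2
      have "(\<Sum>l\<in>pa E i. f' i l (X' w l)) = (\<Sum>l\<in>pa E i. 1 * f i l (X' w l) + (- c) * h l (X' w l))"
        by (rule sum.cong) (use ne jZ in \<open>auto simp: f'_def\<close>)
      then have "(\<Sum>l\<in>pa (flip E i j) k. f' k l (X' w l)) =
          c * X' w j + (- c * \<mu> j) + (\<Sum>l\<in>pa E i. 1 * f i l (X' w l) + (- c) * h l (X' w l))"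
        unfolding 2 paF using jZ ne by (simp add: f'_def)
      then show ?thesis using eqi[of w] by (simp only: 2)
    next
      case 3
      have "X' w k = \<mu> k + (\<Sum>l\<in>pa E k. f k l (X' w l)) + T w k" unfolding X'_def by (rule X_eq)
      then show ?thesis using 3 by (simp add: paF(3) Tk f'_def)
    qed
  qed
  have XT: "X' = X \<circ> T" by (simp add: X'_def fun_eq_iff)
  have X'm: "X' \<in> measurable (noise_space \<sigma>') Rp"
    unfolding XT by (rule measurable_comp[OF T X_measurable])
  have "additive_sem (flip E i j) \<mu> f' \<sigma>' X'"
  proof (rule additive_sem.intro)
    show "acyclic (flip E i j)" by (rule acyclic_flip[OF acyclic cov])
    show "0 < \<sigma>' k" for k unfolding \<sigma>'_def by (rule mixed_sd_pos[OF sd_pos])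
    fix k l assume "l \<in> pa (flip E i j) k"
    note f'[OF this]
    then show "C2 (f' k l)" "integrable (noise_space \<sigma>') (\<lambda>w. f' k l (X' w l))"
      "(\<integral>w. f' k l (X' w l) \<partial>noise_space \<sigma>') = 0"
      using transfer[of "\<lambda>\<omega>. f' k l (X \<omega> l)"] by (simp_all add: X'_def)
  next
    show "X' w k = \<mu> k + (\<Sum>l\<in>pa (flip E i j) k. f' k l (X' w l)) + w k" for w k by (rule X'_eq)
  qed (rule X'm)
  moreover have "distr (noise_space \<sigma>') Rp X' = law"
  proof -
    have "law = distr (distr (noise_space \<sigma>') N T) Rp X" by (simp only: dT)
    also have "\<dots> = distr (noise_space \<sigma>') Rp (X \<circ> T)" by (rule distr_distr[OF X_measurable T])
    finally show ?thesis by (simp only: XT)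
  qed
  ultimately show ?thesis by (rule that)
qed

text \<open>A vanishing function would make two adjacent vertices conditionally independent given
  the other parents, which faithfulness turns into an impossible d-separation. Only the skeleton of
  the faithful graph matters, so the original graph can serve for the flipped one.\<close>

lemma faithful_sem_nonzero:
  assumes sem: "additive_sem F \<mu> f \<sigma> X" and faith: "faithful (distr (noise_space \<sigma>) Rp X) E"
    and sk: "skel F = skel E" and z: "z \<in> pa F j"
  shows "f j z \<noteq> (\<lambda>_. 0)"
proof
  interpret additive_sem F \<mu> f \<sigma> X by (rule sem)
  assume "f j z = (\<lambda>_. 0)"
  then have ci: "cond_indep law {j} {z} (pa F j - {z})" by (rule cond_indep_if_vanishing[OF z])
  have ne: "j \<noteq> z" using z not_self_parent by auto
  have "{j} \<inter> {z} = {}" "{j} \<inter> (pa F j - {z}) = {}" "{z} \<inter> (pa F j - {z}) = {}"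
    using ne not_self_parent by auto
  then have "d_separated E {j} {z} (pa F j - {z})"
    using faith ci unfolding faithful_def by blast
  moreover have "(j, z) \<in> skel E" unfolding sk[symmetric] using z by (simp add: pa_def skel_def)
  ultimately show False using not_d_separated_adjacent ne by metis
qed

subsection \<open>The distribution equivalence class\<close>

lemma distr_equiv_class_iff:
  "E \<in> distr_equiv_class P \<longleftrightarrow> acyclic E \<and> faithful P E \<and> generated_by_PLSEM P E"
  by (simp add: distr_equiv_class_def is_DAG_def)

lemma distr_equiv_class_same_d_sep:
  assumes "E \<in> distr_equiv_class P" "F \<in> distr_equiv_class P"
  shows "same_d_sep E F"
  using assms unfolding distr_equiv_class_iff faithful_def same_d_sep_def by metis

text \<open>\<open>E'\<close> only witnesses that the edge function is affine. The reversed model is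
  built from \<open>E\<close> alone and need not resemble \<open>E'\<close>.\<close>

lemma flip_in_distr_equiv_class:
  fixes E :: "('n::finite \<times> 'n) set"
  assumes E: "E \<in> distr_equiv_class P" and E': "E' \<in> distr_equiv_class P"
    and cov: "covered E i j" and rev: "(j, i) \<in> E'"
  shows "flip E i j \<in> distr_equiv_class P"
proof -
  have ac: "acyclic E" and faith: "faithful P E" using E by (auto simp: distr_equiv_class_iff)
  obtain \<mu> f \<sigma> X where sem: "additive_sem E \<mu> f \<sigma> X" and P: "P = distr (noise_space \<sigma>) Rp X"
    using E unfolding distr_equiv_class_iff using generated_by_PLSEM_iff[OF ac] by blast
  have ac': "acyclic E'" using E' by (simp add: distr_equiv_class_iff)
  obtain \<mu>' f' \<sigma>' X' where sem': "additive_sem E' \<mu>' f' \<sigma>' X'" and P': "P = distr (noise_space \<sigma>') Rp X'"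
    using E' unfolding distr_equiv_class_iff using generated_by_PLSEM_iff[OF ac'] by blast
  interpret S: additive_sem E \<mu> f \<sigma> X by (rule sem)
  interpret sem_pair E \<mu> f \<sigma> X E' \<mu>' f' \<sigma>' X'
    by (intro sem_pair.intro sem_pair_axioms.intro sem sem') (simp only: P[symmetric] P'[symmetric])
  have "i \<in> pa E j" using cov by (simp add: covered_def pa_def)
  then obtain b d where "f j i = (\<lambda>x. b * x + d)"
    using C2_affine_if_deriv2_zero[OF S.C2_f covered_reversed_deriv2_zero[OF cov rev]] by blast
  then obtain g s Y where semF: "additive_sem (flip E i j) \<mu> g s Y" and law: "distr (noise_space s) Rp Y = P"
    using S.reverse_covered_linear[OF cov] P by metis
  have "g k l \<noteq> (\<lambda>_. 0)" if "l \<in> pa (flip E i j) k" for k l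
    by (rule faithful_sem_nonzero[OF semF _ skel_flip[OF cov] that]) (simp only: law faith)
  then have "generated_by_PLSEM P (flip E i j)"
    using generated_by_PLSEM_iff[OF acyclic_flip[OF ac cov]] semF law by blast
  moreover have "faithful P (flip E i j)"
    using faith d_separated_flip[OF ac cov] unfolding faithful_def by metis
  ultimately show ?thesis using acyclic_flip[OF ac cov] by (simp add: distr_equiv_class_iff)
qed

lemma consistent_extension_pdag_of_iff:
  assumes "\<And>F. F \<in> S \<Longrightarrow> skel F = sk" "S \<noteq> {}"
  shows "consistent_extension (pdag_of S) E \<longleftrightarrow>
    acyclic E \<and> skel E = sk \<and> sk \<inter> \<Inter>S \<subseteq> E \<and> vstructs E (skel E) \<subseteq> vstructs (sk \<inter> \<Inter>S) sk"
proof -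
  have Sk: "(\<Union>F\<in>S. skel F) = sk" using assms by auto
  have sym: "(i, j) \<in> sk \<Longrightarrow> (j, i) \<in> sk" for i j using assms by (auto simp: skel_def)
  define Dir where "Dir = {(i, j). (i, j) \<in> sk \<and> (\<forall>F\<in>S. (i, j) \<in> F)}"
  have Dir: "Dir = sk \<inter> \<Inter>S" by (auto simp: Dir_def)
  have "skel Dir \<union> {(i, j). (i, j) \<in> sk \<and> (i, j) \<notin> Dir \<and> (j, i) \<notin> Dir} = sk"
    using sym by (auto simp: skel_def Dir)
  then show ?thesis
    unfolding consistent_extension_def pdag_of_def Sk Let_def is_DAG_def fst_conv snd_conv Dir_def[symmetric]
    by (simp add: Dir)
qed

theorem mainTheorem1:
  fixes P :: "('n::finite \<Rightarrow> real) measure" and D0 :: "('n \<times> 'n) set"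
  assumes "is_DAG D0" and "generated_by_PLSEM P D0" and "faithful P D0"
  shows "distr_equiv_class P = {E. consistent_extension (pdag_of (distr_equiv_class P)) E}"
proof -
  let ?S = "distr_equiv_class P"
  define sk where "sk = skel D0"
  define Dir where "Dir = sk \<inter> \<Inter>?S"
  have D0: "D0 \<in> ?S" using assms by (simp add: distr_equiv_class_def)
  have ac: "acyclic F" if "F \<in> ?S" for F using that by (simp add: distr_equiv_class_iff)
  have same: "skel F = sk" "vstructs F sk = vstructs D0 sk" if "F \<in> ?S" for F
  proof -
    note s = ac[OF that] ac[OF D0] distr_equiv_class_same_d_sep[OF that D0]
    show "skel F = sk" using same_d_sep_skel[OF s] by (simp add: sk_def)
    then show "vstructs F sk = vstructs D0 sk" using same_d_sep_vstructs[OF s] by (simp add: sk_def)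
  qed
  have cons: "consistent_extension (pdag_of ?S) E \<longleftrightarrow>
      acyclic E \<and> skel E = sk \<and> Dir \<subseteq> E \<and> vstructs E (skel E) \<subseteq> vstructs Dir sk" for E
    unfolding Dir_def using D0 by (intro consistent_extension_pdag_of_iff same(1)) auto
  \<comment> \<open>A v-structure is common to all members, so both of its edges are directed in the
    PDAG.\<close>
  have vs_Dir: "vstructs F sk \<subseteq> vstructs Dir sk" if "F \<in> ?S" for F
  proof clarify
    fix i k j assume "(i, k, j) \<in> vstructs F sk"
    then have v: "(i, k, j) \<in> vstructs F' sk" if "F' \<in> ?S" for F'
      using same(2)[OF that] same(2)[OF \<open>F \<in> ?S\<close>] by simp
    then have "(i, k) \<in> F' \<and> (j, k) \<in> F'" if "F' \<in> ?S" for F'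
      using that by (auto simp: vstructs_def)
    then have "(i, k) \<in> Dir" "(j, k) \<in> Dir"
      using D0 by (auto simp: Dir_def sk_def skel_def)
    then show "(i, k, j) \<in> vstructs Dir sk" using v[OF D0] by (auto simp: vstructs_def)
  qed
  have vs_mono: "vstructs A sk \<subseteq> vstructs B sk" if "A \<subseteq> B" for A B :: "('n \<times> 'n) set"
    using that by (auto simp: vstructs_def)
  have "E \<in> ?S" if "consistent_extension (pdag_of ?S) E" for E
  proof -
    have E: "acyclic E" "skel E = sk" "Dir \<subseteq> E" "vstructs E sk \<subseteq> vstructs Dir sk"
      using that cons by auto
    obtain D where D: "D \<in> ?S" and least: "\<And>F. F \<in> ?S \<Longrightarrow> card (D - E) \<le> card (F - E)"
      using ex_has_least_nat[of "\<lambda>F. F \<in> ?S" D0 "\<lambda>F. card (F - E)"] D0 by blast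
    have "Dir \<subseteq> D" using D by (auto simp: Dir_def)
    \<comment> \<open>Both sides equal the v-structures of \<open>Dir\<close>: they contain these
      because \<open>Dir\<close> is a subset of \<open>D\<close> and of \<open>E\<close>, and
      nothing more by \<open>vs_Dir\<close> and by consistency of the extension.\<close>
    then have vs: "vstructs D (skel D) = vstructs E (skel E)"
      using vs_Dir[OF D] vs_mono[of Dir D] vs_mono[OF E(3)] E(2,4) same(1)[OF D] by auto
    have skDE: "skel D = skel E" using E(2) same(1)[OF D] by simp
    show ?thesis
    proof (cases "D \<subseteq> E")
      case True
      have "E \<subseteq> D"
      proof clarify
        fix i j assume ij: "(i, j) \<in> E"
        then have "(i, j) \<in> skel D" by (simp add: skDE) (simp add: skel_def)
        then show "(i, j) \<in> D" using True acyclic_asym[OF E(1) ij] by (auto simp: skel_def)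
      qed
      then show ?thesis using D True by (metis subset_antisym)
    next
      case False
      then obtain i j where cov: "covered D i j" and ij: "(i, j) \<notin> E" "(j, i) \<in> E"
        using covered_edge_exists[OF ac[OF D] E(1) skDE vs] by blast
      have ijD: "(i, j) \<in> D" using cov by (simp add: covered_def)
      then have "(i, j) \<in> sk" using same(1)[OF D] by (auto simp: skel_def)
      then obtain D' where D': "D' \<in> ?S" "(i, j) \<notin> D'" using ij(1) E(3) by (auto simp: Dir_def)
      have "(j, i) \<in> D'" using same(1)[OF D'(1)] D'(2) \<open>(i, j) \<in> sk\<close> by (auto simp: skel_def)
      then have "flip D i j \<in> ?S" by (rule flip_in_distr_equiv_class[OF D D'(1) cov])
      then have "card (D - E) \<le> card (flip D i j - E)" by (rule least)
      \<comment> \<open>The new edge j -> i belongs to \<open>E\<close>, so the flip removes one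
        disagreement and creates none.\<close>
      moreover have "flip D i j - E = (D - E) - {(i, j)}" using ij(2) by (auto simp: flip_def)
      moreover have "card ((D - E) - {(i, j)}) < card (D - E)"
        using ijD ij(1) by (intro card_Diff1_less) auto
      ultimately show ?thesis by simp
    qed
  qed
  moreover have "consistent_extension (pdag_of ?S) E" if "E \<in> ?S" for E
    using that cons ac same vs_Dir by (auto simp: Dir_def)
  ultimately show ?thesis by blast
qed

end
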